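(* Let $x$ and $n$ be positive integers with $n$ odd. Then there exists a constant $C$, depending only on $x$ and $n$, such that for every positive integer $y$ with $x^2<y^n$, $\gcd(2x,y)=1$ and $y>C$, the class number of the imaginary quadratic field $\mathbb{Q}(\sqrt{x^{2}-y^{n}})$ is divisible by $n$.
   Context: The class number of a number field is the order of the ideal class group of its ring of integers. *)

theory Defs
  imports
    "HOL-Algebra.Algebra"
    "HOL-Algebra.Algebraic_Closure_Type"
    "HOL-Computational_Algebra.Computational_Algebra"
begin

text \<open>
  Number fields are subfields of the complex numbers, represented by their carrier sets.
\<close>

abbreviation complex_ring :: "complex ring"
  where "complex_ring \<equiv> ring_of_type_algebra"

text \<open>
  The prime field being the rationals, \<open>rat_adjoin s\<close> is the field obtained by adjoining \<open>s\<close>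
  to the rationals.
\<close>

definition rat_adjoin :: "complex \<Rightarrow> complex set"
  where "rat_adjoin s = generate_field complex_ring {s}"

definition ring_of_integers :: "complex set \<Rightarrow> complex ring"
  where "ring_of_integers K = complex_ring\<lparr>carrier := {z \<in> K. algebraic_int z}\<rparr>"

definition fractional_ideal :: "complex set \<Rightarrow> complex set \<Rightarrow> bool"
  where "fractional_ideal K J \<longleftrightarrow> J \<subseteq> K \<and>
    (\<exists>d \<in> carrier (ring_of_integers K) - {0}. ideal ((\<lambda>z. d * z) ` J) (ring_of_integers K))"

text \<open>
  The product \<open>ideal_prod\<close> (finite sums of products of elements) is taken in the complex
  numbers, since fractional ideals need not lie in the ring of integers.
\<close>

definition fractional_ideal_group :: "complex set \<Rightarrow> complex set monoid"
  where "fractional_ideal_group K =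
    \<lparr> carrier = {J. fractional_ideal K J \<and> J \<noteq> {0}},
      monoid.mult = ideal_prod complex_ring,
      one = carrier (ring_of_integers K) \<rparr>"

definition principal_fractional_ideals :: "complex set \<Rightarrow> complex set set"
  where "principal_fractional_ideals K =
    {(\<lambda>z. c * z) ` carrier (ring_of_integers K) | c. c \<in> K - {0}}"

definition ideal_class_group :: "complex set \<Rightarrow> complex set set monoid"
  where "ideal_class_group K = fractional_ideal_group K Mod principal_fractional_ideals K"

definition class_number :: "complex set \<Rightarrow> nat"
  where "class_number K = Coset.order (ideal_class_group K)"

end

theory Submission
  imports Defs
begin

text \<open>
  Let \<open>K = \<rat>(s)\<close> with \<open>s\<^sup>2 = x\<^sup>2 - y ^ n\<close> and let \<open>a = x + s\<close>, an integral element of trace \<open>2 x\<close> and norm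
  \<open>y ^ n\<close>. Since \<open>2 x\<close> and \<open>y\<close> are coprime, \<open>a\<close> and its conjugate are coprime, and the principal ideal
  generated by \<open>a\<close> is the \<open>n\<close>-th power of the ideal \<open>A\<close> generated by \<open>a\<close> and \<open>y\<close> (\<open>root_power_n\<close>). The
  class of \<open>A\<close> therefore has an order that divides \<open>n\<close>, and if this order is exactly \<open>n\<close>, then \<open>n\<close> divides the order of
  the class group (\<open>dvd_order_Mod\<close>).
  
  Suppose the order is a proper divisor of \<open>n\<close>. Then for some prime \<open>p\<close> dividing \<open>n\<close> the power of
  \<open>A\<close> with exponent \<open>n div p\<close> is principal, say generated by \<open>c\<close>, and \<open>a = u * c ^ p\<close> for a unit \<open>u\<close>.
  The units are roots of unity, and \<open>u\<close> can be absorbed into the power, except when \<open>p = 3\<close> and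
  \<open>u\<close> has order 3 or 6 (\<open>unit_is_pth_power_or_cube_root\<close>); in that case the trace of \<open>a\<close> would be odd
  (\<open>trace_omega_cube_odd\<close>), but it is \<open>2 x\<close>. So \<open>a = g ^ p\<close>, where \<open>g\<close> has some trace \<open>t\<close> and the norm
  \<open>Y = y ^ (n div p) \<ge> y\<close>. The equation \<open>2 x = g ^ p + cnj g ^ p\<close> expresses \<open>2 x\<close> as an
  integer polynomial in \<open>t\<close> and \<open>Y\<close>. The trace \<open>t\<close> divides it, so \<open>t\<close> takes finitely many values, and for
  each of them a congruence modulo \<open>Y\<^sup>2\<close> bounds \<open>Y\<close> (\<open>lucas_V_bound\<close>). For \<open>y\<close> beyond this bound the
  order of the class is \<open>n\<close>. A lower bound for the norm of \<open>c\<close> in terms of the discriminant of \<open>K\<close> would not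
  do, because \<open>x\<^sup>2 - y ^ n\<close> may have large square factors; the divisibility by \<open>t\<close> replaces it.
  
  The ideal classes form a group because every nonzero ideal times its conjugate is generated by an integer
  (\<open>integral_mult_cnj\<close>). This rests on describing integral elements by their traces and norms
  (\<open>integers_iff\<close>).
\<close>

section \<open>Integral elements of quadratic fields\<close>

lemma of_int_poly_mult: "map_poly of_int (p * q) = (map_poly of_int p * map_poly of_int q :: complex poly)"
  by (intro poly_eqI) (simp add: coeff_map_poly coeff_mult)

lemma of_int_poly_add: "map_poly of_int (p + q) = (map_poly of_int p + map_poly of_int q :: complex poly)"
  by (intro poly_eqI) (simp add: coeff_map_poly)

lemma nonreal_linear_root:
  fixes r :: "int poly" and z :: complex
  assumes "Im z \<noteq> 0" "Polynomial.degree r < 2" "poly (map_poly of_int r) z = 0"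
  shows "r = 0"
proof -
  obtain a b where r: "r = [:a, b:]"
    using assms(2) by (cases r rule: pCons_cases, rename_tac a r', case_tac r' rule: pCons_cases)
      (auto split: if_splits)
  with assms(3) have "of_int a + z * of_int b = 0"
    by (simp add: map_poly_pCons)
  moreover from arg_cong[OF this, of Im] have "b = 0"
    using assms(1) by simp
  ultimately show ?thesis
    using r by simp
qed

text \<open>
  This is Gauss's lemma for the minimal polynomial \<open>X\<^sup>2 - (z + cnj z) X + z * cnj z\<close>. Clearing
  denominators and the content gives a primitive integer polynomial \<open>q'\<close> with root \<open>z\<close> and
  leading coefficient \<open>g\<close>. Pseudo-division of a monic integer polynomial \<open>p\<close> with root \<open>z\<close> by
  \<open>q'\<close> leaves a remainder of degree at most one with the nonreal root \<open>z\<close>, hence none. As \<open>q'\<close> is primitive,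
  the factor \<open>g ^ m\<close> that pseudo-division introduces can be moved into the cofactor, so \<open>g\<close>
  divides the leading coefficient 1 of \<open>p\<close>.
\<close>

lemma nonreal_algebraic_int_monic:
  fixes z :: complex
  assumes z: "algebraic_int z" "Im z \<noteq> 0"
    and tr: "z + cnj z \<in> \<rat>" and nm: "z * cnj z \<in> \<rat>"
  shows "z + cnj z \<in> \<int>" and "z * cnj z \<in> \<int>"
proof -
  obtain p where p: "poly (map_poly of_int p) z = 0" "lead_coeff p = 1"
    using z(1) by (auto simp: algebraic_int_altdef_ipoly)
  obtain a b where ab: "b > 0" "z + cnj z = of_int a / of_int b"
    using tr by (auto elim: Rats_cases')
  obtain c d where cd: "d > 0" "z * cnj z = of_int c / of_int d"
    using nm by (auto elim: Rats_cases')
  define q where "q = [:c * b, - a * d, b * d:]"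
  have "q \<noteq> 0" using ab cd by (simp add: q_def)
  define q' where "q' = primitive_part q"
  define k where "k = content q"
  have k: "q = smult k q'" "k \<noteq> 0" and q': "content q' = 1" "q' \<noteq> 0"
    using \<open>q \<noteq> 0\<close> by (simp_all add: q'_def k_def)
  have deg: "Polynomial.degree q' = 2"
  proof -
    have "Polynomial.degree q = 2" using ab cd by (simp add: q_def)
    thus ?thesis using k degree_smult_eq[of k q'] by simp
  qed
  define e f g where "e = Polynomial.coeff q' 0" and "f = Polynomial.coeff q' 1" and "g = Polynomial.coeff q' 2"
  have efg: "c * b = k * e" "- a * d = k * f" "b * d = k * g"
    using arg_cong[OF k(1), of "\<lambda>p. Polynomial.coeff p 0"] arg_cong[OF k(1), of "\<lambda>p. Polynomial.coeff p 1"]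
      arg_cong[OF k(1), of "\<lambda>p. Polynomial.coeff p 2"]
    by (simp_all add: q_def e_def f_def g_def numeral_2_eq_2)
  have "g \<noteq> 0" using efg ab cd by auto
  have "z ^ 2 = (z + cnj z) * z - z * cnj z"
    by (simp add: power2_eq_square algebra_simps)
  hence "of_int (b * d) * z ^ 2 + of_int (- a * d) * z + of_int (c * b) = 0"
    using ab cd by (simp add: field_simps)
  hence "of_int k * poly (map_poly of_int q') z = 0"
    unfolding efg using deg
    by (simp add: poly_altdef degree_map_poly coeff_map_poly numeral_2_eq_2 e_def f_def g_def algebra_simps)
  hence q'z: "poly (map_poly of_int q') z = 0" using k by simp
  obtain s r where sr: "pseudo_divmod p q' = (s, r)" by (cases "pseudo_divmod p q'")
  define m where "m = Suc (Polynomial.degree p) - 2"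
  have eq: "smult (g ^ m) p = q' * s + r" and r: "r = 0 \<or> Polynomial.degree r < 2"
    using pseudo_divmod[OF q'(2) sr] deg by (simp_all add: g_def m_def)
  have "poly (map_poly of_int (smult (g ^ m) p)) z = 0"
    using p by (simp add: map_poly_smult)
  hence "poly (map_poly of_int r) z = 0"
    unfolding eq by (simp add: of_int_poly_add of_int_poly_mult q'z)
  hence "r = 0" using r nonreal_linear_root z(2) by auto
  hence eq: "smult (g ^ m) p = q' * s" using eq by simp
  have "content p dvd 1" using content_dvd_coeff[of p "Polynomial.degree p"] p(2) by simp
  hence "content p = 1"
    by (metis is_unit_normalize normalize_content)
  hence "content s = \<bar>g ^ m\<bar>"
    using arg_cong[OF eq, of content] q' by (simp add: content_mult)
  then obtain s' where s: "s = smult (\<bar>g ^ m\<bar>) s'"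
    by (metis content_times_primitive_part)
  have "g ^ m = g * (\<bar>g ^ m\<bar> * lead_coeff s')"
  proof -
    have "lead_coeff (smult (g ^ m) p) = g ^ m" using p(2) by (simp only: lead_coeff_smult)
    moreover have "lead_coeff (q' * s) = g * (\<bar>g ^ m\<bar> * lead_coeff s')"
      using deg unfolding s by (simp only: lead_coeff_smult lead_coeff_mult g_def)
    ultimately show ?thesis using eq by simp
  qed
  moreover have "\<bar>g ^ m\<bar> = g ^ m * sgn (g ^ m)" by (simp add: abs_sgn)
  ultimately have "g ^ m * 1 = g ^ m * (g * (sgn (g ^ m) * lead_coeff s'))" by (simp add: mult_ac)
  hence "1 = g * (sgn (g ^ m) * lead_coeff s')"
    using \<open>g \<noteq> 0\<close> by (metis mult_left_cancel power_not_zero)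
  hence "g dvd 1" by (metis dvdI)
  hence g: "g = 1 \<or> g = -1" using zdvd1_eq[of g] by arith
  have "z + cnj z = of_int (a * d) / of_int (b * d)" using ab cd by simp
  also have "a * d = - (k * f)" using efg(2) by simp
  also have "of_int (- (k * f)) / of_int (b * d) = (of_int (- (f * g)) :: complex)"
    unfolding efg using g k(2) by auto
  finally show "z + cnj z \<in> \<int>" by simp
  have "z * cnj z = of_int (c * b) / of_int (b * d)" using ab cd by simp
  also have "\<dots> = (of_int (e * g) :: complex)"
    unfolding efg using g k(2) by auto
  finally show "z * cnj z \<in> \<int>" by simp
qed

lemma algebraic_int_quadratic:
  fixes z :: complex
  assumes "z ^ 2 = t * z - N" "t \<in> \<int>" "N \<in> \<int>"
  shows "algebraic_int z"
proof
  show "lead_coeff [:N, - t, 1:] = 1" by simp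
  show "\<forall>i. Polynomial.coeff [:N, - t, 1:] i \<in> \<int>"
    using assms by (auto simp: coeff_pCons split: nat.splits)
  show "poly [:N, - t, 1:] z = 0" using assms(1) by (simp add: power2_eq_square algebra_simps)
qed

section \<open>The Lucas sequence of power sums\<close>

text \<open>
  \<open>lucas_V t Y k\<close> is the power sum \<open>a ^ k + b ^ k\<close> of the roots of \<open>X\<^sup>2 - t X + Y\<close>, as an
  integer sequence in the trace \<open>t\<close> and the norm \<open>Y\<close>.
\<close>

fun lucas_V :: "int \<Rightarrow> int \<Rightarrow> nat \<Rightarrow> int" where
  "lucas_V t Y 0 = 2"
| "lucas_V t Y (Suc 0) = t"
| "lucas_V t Y (Suc (Suc k)) = t * lucas_V t Y (Suc k) - Y * lucas_V t Y k"

lemma power_sum_eq_lucas_V: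
  fixes a b :: "'a :: comm_ring_1"
  assumes "a + b = of_int t" "a * b = of_int Y"
  shows "a ^ k + b ^ k = of_int (lucas_V t Y k)"
  using assms
proof (induction t Y k rule: lucas_V.induct)
  case (3 t Y k)
  have "a ^ Suc (Suc k) + b ^ Suc (Suc k) = (a + b) * (a ^ Suc k + b ^ Suc k) - a * b * (a ^ k + b ^ k)"
    by (simp add: algebra_simps)
  thus ?case using 3 by simp
qed auto

lemma dvd_lucas_V_odd: "odd k \<Longrightarrow> t dvd lucas_V t Y k"
  by (induction t Y k rule: lucas_V.induct) auto

lemma lucas_V_mod_square:
  "\<exists>c. lucas_V t Y (k + 2) = t ^ (k + 2) - int (k + 2) * t ^ k * Y + c * Y ^ 2"
proof (induction k rule: less_induct)
  case (less k)
  consider "k = 0" | "k = 1" | j where "k = Suc (Suc j)"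
    by (metis One_nat_def not0_implies_Suc)
  thus ?case
  proof cases
    case 1 thus ?thesis by (intro exI[of _ 0]) (simp add: numeral_2_eq_2)
  next
    case 2 thus ?thesis by (intro exI[of _ 0]) (simp add: numeral_2_eq_2 numeral_3_eq_3 algebra_simps)
  next
    case 3
    obtain c c' where
      c: "lucas_V t Y (Suc j + 2) = t ^ (Suc j + 2) - int (Suc j + 2) * t ^ Suc j * Y + c * Y ^ 2" and
      c': "lucas_V t Y (j + 2) = t ^ (j + 2) - int (j + 2) * t ^ j * Y + c' * Y ^ 2"
      using less.IH[of "Suc j"] less.IH[of j] 3 by auto
    have "lucas_V t Y (k + 2) = t * lucas_V t Y (Suc j + 2) - Y * lucas_V t Y (j + 2)"
      using 3 by simp
    also have "\<dots> = t ^ (k + 2) - int (k + 2) * t ^ k * Y + (t * c + int (j + 2) * t ^ j - c' * Y) * Y ^ 2"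
      unfolding c c' using 3 by (simp add: algebra_simps power2_eq_square)
    finally show ?thesis by blast
  qed
qed

text \<open>
  A positive power sum \<open>m\<close> of odd exponent bounds the norm \<open>Y\<close>: it bounds the trace, because \<open>t\<close>
  divides \<open>m\<close> (and is therefore nonzero), and then \<open>Y\<close> divides a nonzero integer that depends on \<open>t\<close>, \<open>m\<close> and \<open>p\<close> only. This
  integer is \<open>m - t ^ p\<close> in general; if \<open>m = t ^ p\<close>, the expansion modulo \<open>Y\<^sup>2\<close> shows that
  \<open>Y\<close> divides \<open>p * t ^ (p - 2)\<close> instead.
\<close>

lemma lucas_V_bound:
  assumes p: "odd p" "p \<ge> 3" and m: "m > 0" "lucas_V t Y p = m" and Y: "Y > 0"
  shows "Y \<le> int p * m ^ p + m"
proof -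
  have "t dvd m" using dvd_lucas_V_odd[OF p(1)] m by metis
  hence t: "t \<noteq> 0" "\<bar>t\<bar> \<le> m" using m(1) dvd_imp_le_int[of m t] by auto
  have tk: "\<bar>t ^ k\<bar> \<le> m ^ p" if "k \<le> p" for k
  proof -
    have "\<bar>t ^ k\<bar> \<le> m ^ k" using t by (simp add: power_abs power_mono)
    moreover have "m ^ k \<le> m ^ p" using that m(1) by (intro power_increasing) auto
    ultimately show ?thesis by linarith
  qed
  obtain k where k: "p = k + 2" using p(2) by (metis add.commute le_Suc_ex numeral_3_eq_3 numeral_2_eq_2 add_Suc_shift Suc_eq_plus1 add_2_eq_Suc)
  obtain c where c: "m = t ^ p - int p * t ^ k * Y + c * Y ^ 2"
    using lucas_V_mod_square[of t Y k] m(2) unfolding k by blast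
  show ?thesis
  proof (cases "m = t ^ p")
    case False
    have "m - t ^ p = Y * (c * Y - int p * t ^ k)" using c by (simp add: algebra_simps power2_eq_square)
    hence "Y dvd m - t ^ p" by simp
    hence "Y \<le> \<bar>m - t ^ p\<bar>" using False Y by (metis abs_of_pos dvd_imp_le_int eq_iff_diff_eq_0)
    also have "\<dots> \<le> m + m ^ p" using tk[of p] m(1) by linarith
    also have "\<dots> \<le> m + int p * m ^ p" using p m(1) by simp
    finally show ?thesis by simp
  next
    case True
    have "Y * (int p * t ^ k) = Y * (c * Y)" using c True by (simp add: algebra_simps power2_eq_square)
    hence "int p * t ^ k = c * Y" using Y by simp
    hence "Y \<le> \<bar>int p * t ^ k\<bar>" using t(1) p(2) Y by (metis abs_of_pos dvd_imp_le_int dvd_triv_right mult_eq_0_iff of_nat_eq_0_iff power_not_zero not_numeral_le_zero)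
    also have "\<dots> \<le> int p * m ^ p" using tk[of k] k by (simp add: abs_mult mult_left_mono)
    finally show ?thesis using m(1) by simp
  qed
qed

section \<open>Units of norm one\<close>

lemma odd_prime_square_mod_12:
  assumes "Factorial_Ring.prime p" "odd p" "p \<noteq> (3::nat)"
  shows "p * p mod 12 = 1"
proof -
  have "p mod 3 \<noteq> 0" using assms primes_dvd_imp_eq[of 3 p] by (auto simp: dvd_eq_mod_eq_0)
  moreover have "p mod 2 \<noteq> 0" using assms by (simp add: even_iff_mod_2_eq_zero)
  moreover have "p mod 12 mod 3 = p mod 3" "p mod 12 mod 2 = p mod 2"
    by (simp_all add: mod_mod_cancel)
  moreover have "m * m mod 12 = 1" if "m < 12" "m mod 3 \<noteq> 0" "m mod 2 \<noteq> 0" for m :: nat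
  proof -
    from that(1) have "m = 0 \<or> m = 1 \<or> m = 2 \<or> m = 3 \<or> m = 4 \<or> m = 5 \<or> m = 6 \<or> m = 7 \<or>
        m = 8 \<or> m = 9 \<or> m = 10 \<or> m = 11" by presburger
    thus ?thesis using that(2,3) by (elim disjE) simp_all
  qed
  moreover have "p mod 12 < 12" by simp
  ultimately have "(p mod 12) * (p mod 12) mod 12 = 1" by simp
  thus ?thesis by (simp only: mod_mult_eq)
qed

text \<open>
  A unit \<open>u\<close> of norm one has an integral trace in \<open>{-2..2}\<close>, so it is a root of unity of order
  1, 2, 3, 4 or 6. The conclusion \<open>u ^ (p * p) = u\<close> says that \<open>u\<close> is the \<open>p\<close>-th power of
  \<open>u ^ p\<close>. It follows from \<open>u ^ 12 = 1\<close> and \<open>p\<^sup>2 \<equiv> 1\<close> modulo 12 unless \<open>p = 3\<close>, and for \<open>p = 3\<close> it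
  only fails if the order of \<open>u\<close> is 3 or 6.
\<close>

lemma unit_is_pth_power_or_cube_root:
  fixes u :: complex
  assumes N: "u * cnj u = 1" and tr: "u + cnj u \<in> \<int>" and p: "Factorial_Ring.prime p" "odd p"
  shows "u ^ (p * p) = u \<or> p = 3 \<and> (\<exists>\<sigma>\<in>{1, -1}. (\<sigma> * u) ^ 2 + \<sigma> * u + 1 = 0)"
proof -
  obtain t where t: "u + cnj u = of_int t" using tr by (auto elim: Ints_cases)
  have "norm u ^ 2 = 1" using N by (metis complex_norm_square of_real_eq_1_iff)
  hence "norm u = 1" by (simp add: power2_eq_1_iff) (use norm_ge_zero[of u] in linarith)
  hence "norm (u + cnj u) \<le> 2" using norm_triangle_ineq[of u "cnj u"] by simp
  hence "\<bar>t\<bar> \<le> 2" unfolding t by simp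
  hence "t = -2 \<or> t = -1 \<or> t = 0 \<or> t = 1 \<or> t = 2" by linarith
  moreover have u2: "u ^ 2 = of_int t * u - 1" using N t by (simp add: power2_eq_square algebra_simps flip: t)
  have 9: "u ^ (p * p) = u" if "u ^ 12 = 1" "p \<noteq> 3"
  proof -
    have "u ^ (p * p) = u ^ (12 * (p * p div 12) + 1)" using odd_prime_square_mod_12[OF p that(2)]
      by (metis mult_div_mod_eq)
    also have "\<dots> = u" using that(1) by (simp add: power_mult)
    finally show ?thesis .
  qed
  have 4: "u ^ (p * p) = u" if "u ^ 4 = 1"
  proof (cases "p = 3")
    case True
    have "u ^ (p * p) = (u ^ 4) ^ 2 * u" using True by (simp flip: power_mult power_Suc2)
    thus ?thesis using that by simp
  next
    case False
    have "u ^ 12 = (u ^ 4) ^ 3" by (simp flip: power_mult)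
    thus ?thesis using that 9 False by simp
  qed
  have 3: ?thesis if "\<sigma> \<in> {1, -1}" "(\<sigma> * u) ^ 2 + \<sigma> * u + 1 = 0" for \<sigma>
  proof (cases "p = 3")
    case True thus ?thesis using that by blast
  next
    case False
    define w where "w = \<sigma> * u"
    have "w ^ 3 - 1 = (w - 1) * (w ^ 2 + w + 1)" by (simp add: algebra_simps power2_eq_square power3_eq_cube)
    hence "w ^ 3 = 1" using that(2) by (simp add: w_def)
    hence "w ^ 12 = 1" using power_mult[of w 3 4] by simp
    hence "u ^ 12 = 1" using that(1) by (auto simp: w_def)
    thus ?thesis using 9 False by blast
  qed
  ultimately consider "t = 2" | "t = -2" | "t = 0" | "t = 1" | "t = -1" by blast
  thus ?thesis
  proof cases
    case 1
    have "(u - 1) ^ 2 = 0" using u2 1 by (simp add: power2_eq_square algebra_simps)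
    thus ?thesis using 4 by simp
  next
    case 2
    have "(u + 1) ^ 2 = u ^ 2 + 2 * u + 1" by (simp add: power2_eq_square algebra_simps)
    hence "(u + 1) ^ 2 = 0" using u2 2 by simp
    hence "u = -1" by (simp add: eq_neg_iff_add_eq_0)
    thus ?thesis using 4 by simp
  next
    case 3
    have "u ^ 4 = (u ^ 2) ^ 2" by (simp flip: power_mult)
    thus ?thesis using 4 u2 3 by simp
  next
    case 4
    thus ?thesis using 3[of "-1"] u2 by simp
  next
    case 5
    thus ?thesis using 3[of 1] u2 by simp
  qed
qed

text \<open>
  This excludes the exceptional units. Let \<open>w\<close> be a primitive cube root of unity. The trace \<open>m\<close> of
  \<open>w * b ^ 3\<close> is a polynomial in the traces \<open>t\<close> of \<open>b\<close> and \<open>r\<close> of \<open>w * b\<close> and in the norm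
  \<open>N\<close>, and \<open>t\<^sup>2 + t r + r\<^sup>2 = 3 N\<close>, since \<open>1 + w + w\<^sup>2 = 0\<close> cancels the squares of \<open>b\<close> and
  \<open>cnj b\<close> on the left. If \<open>N\<close> is odd, \<open>t\<close> and \<open>r\<close> are not both even, and then \<open>m\<close> is odd.
\<close>

lemma trace_omega_cube_odd:
  fixes w b :: complex
  assumes w: "w ^ 2 + w + 1 = 0" "cnj w = w ^ 2"
    and t: "b + cnj b = of_int t" and r: "w * b + cnj (w * b) = of_int r"
    and N: "b * cnj b = of_int N" and odd: "odd N"
    and m: "w * b ^ 3 + cnj (w * b ^ 3) = of_int m"
  shows "odd m"
proof -
  define h where "h = cnj b"
  have w2: "w ^ 2 = - w - 1" using w(1) by (simp add: algebra_simps eq_neg_iff_add_eq_0)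
  have w4: "w * w = - w - 1" using w2 by (simp add: power2_eq_square)
  have cw: "cnj w = - w - 1" using w w2 by simp
  have t': "b + h = of_int t" and N': "b * h = of_int N" using t N by (simp_all add: h_def)
  have r': "w * b + (- w - 1) * h = of_int r" and m': "w * b ^ 3 + (- w - 1) * h ^ 3 = of_int m"
    using r m by (simp_all add: h_def cw)
  have "(b + h) ^ 2 + (b + h) * (w * b + (- w - 1) * h) + (w * b + (- w - 1) * h) ^ 2 = 3 * (b * h)"
  proof -
    have "(b + h) ^ 2 + (b + h) * (w * b + (- w - 1) * h) + (w * b + (- w - 1) * h) ^ 2 - 3 * (b * h)
        = (w * w + w + 1) * (b - h) ^ 2"
      by (simp add: algebra_simps power2_eq_square)
    thus ?thesis using w4 by simp
  qed
  hence "of_int (t ^ 2 + t * r + r ^ 2) = (of_int (3 * N) :: complex)"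
    unfolding t' r' N' by simp
  hence e1: "t ^ 2 + t * r + r ^ 2 = 3 * N" by (metis of_int_eq_iff)
  have "w * b ^ 3 + (- w - 1) * h ^ 3 = ((b + h) ^ 2 - b * h) * (w * b + (- w - 1) * h) + (b + h) * (b * h)"
    by (simp add: algebra_simps power2_eq_square power3_eq_cube)
  hence "of_int m = (of_int ((t ^ 2 - N) * r + t * N) :: complex)"
    unfolding t' r' N' m' by simp
  hence e2: "m = (t ^ 2 - N) * r + t * N" by (metis of_int_eq_iff)
  have "odd (t ^ 2 + t * r + r ^ 2)" unfolding e1 using odd by simp
  thus ?thesis unfolding e2 using odd by auto
qed

section \<open>The order of a class in a quotient group\<close>

text \<open>
  The hypotheses say that the class of \<open>a\<close> has order exactly \<open>n\<close>: a proper divisor of \<open>n\<close> divides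
  \<open>n div p\<close> for some prime \<open>p\<close>. The quotient may be infinite, its order then being 0.
\<close>

lemma (in comm_group) dvd_order_Mod:
  assumes H: "subgroup H G" and a: "a \<in> carrier G" and n: "n > 0" "a [^] n \<in> H"
    and min: "\<And>p. Factorial_Ring.prime p \<Longrightarrow> p dvd n \<Longrightarrow> a [^] (n div p) \<notin> H"
  shows "n dvd Coset.order (G Mod H)"
proof -
  have "H \<lhd> G" using H by (simp add: normal_iff_subgroup)
  then interpret N: normal H G .
  interpret F: group "G Mod H" by (rule N.factorgroup_is_group)
  define c where "c = H #> a"
  have c: "c \<in> carrier (G Mod H)" using a by (simp add: c_def carrier_FactGroup)
  have pow: "c [^]\<^bsub>G Mod H\<^esub> k = \<one>\<^bsub>G Mod H\<^esub> \<longleftrightarrow> a [^] k \<in> H" for k :: nat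
  proof -
    have "c [^]\<^bsub>G Mod H\<^esub> k = H #> a [^] k"
      using hom_nat_pow[OF N.r_coset_hom_Mod a is_group F.is_group] by (simp add: c_def)
    moreover have "H #> a [^] k = H \<longleftrightarrow> a [^] k \<in> H"
      using coset_join1[OF _ _ H] coset_join2[OF _ H] a subgroup.subset[OF H] by blast
    ultimately show ?thesis by simp
  qed
  have "F.ord c dvd n" using F.pow_eq_id[OF c] pow n by simp
  then obtain q where q: "n = F.ord c * q" by blast
  have "q = 1"
  proof (rule ccontr)
    assume "q \<noteq> 1"
    then obtain p where p: "Factorial_Ring.prime p" "p dvd q" using prime_factor_nat by blast
    then obtain q' where q': "q = p * q'" by blast
    have "n div p = F.ord c * q'" using q q' p(1) by (simp add: prime_gt_0_nat)
    hence "F.ord c dvd n div p" by simp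
    hence "a [^] (n div p) \<in> H" using F.pow_eq_id[OF c] pow by blast
    thus False using min[OF p(1)] q p(2) by simp
  qed
  thus ?thesis using q F.ord_dvd_group_order[OF c] by simp
qed

section \<open>Products of additive subsets of the complex numbers\<close>

abbreviation span_prod :: "complex set \<Rightarrow> complex set \<Rightarrow> complex set" (infixl "\<star>" 70)
  where "I \<star> J \<equiv> ideal_prod complex_ring I J"

abbreviation scale :: "complex \<Rightarrow> complex set \<Rightarrow> complex set" (infixr "\<bullet>" 75)
  where "c \<bullet> J \<equiv> (\<lambda>z. c * z) ` J"

lemma complex_ring_simps [simp]:
  "carrier complex_ring = UNIV" "a \<otimes>\<^bsub>complex_ring\<^esub> b = a * b" "a \<oplus>\<^bsub>complex_ring\<^esub> b = a + b"
  "\<one>\<^bsub>complex_ring\<^esub> = 1" "\<zero>\<^bsub>complex_ring\<^esub> = 0"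
  by (simp_all add: ring_of_type_algebra_def)

lemma complex_field: "Ring.field complex_ring"
  by (rule field_from_type_algebra)

lemma complex_ring_minus [simp]: "\<ominus>\<^bsub>complex_ring\<^esub> a = - a"
proof -
  interpret Ring.field complex_ring by (rule complex_field)
  show ?thesis using minus_equality[of "-a" a] by simp
qed

lemma complex_ring_inv [simp]: "a \<noteq> 0 \<Longrightarrow> inv\<^bsub>complex_ring\<^esub> a = inverse a"
proof -
  interpret Ring.field complex_ring by (rule complex_field)
  assume "a \<noteq> 0" thus ?thesis using comm_inv_char[of a "inverse a"] by simp
qed

lemma span_prod_mult: "i \<in> I \<Longrightarrow> j \<in> J \<Longrightarrow> i * j \<in> I \<star> J"
  using ideal_prod.prod[of i I j J complex_ring] by simp

lemma span_prod_add: "a \<in> I \<star> J \<Longrightarrow> b \<in> I \<star> J \<Longrightarrow> a + b \<in> I \<star> J"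
  using ideal_prod.sum[of a complex_ring I J b] by simp

lemma span_prod_least:
  assumes "\<And>i j. i \<in> I \<Longrightarrow> j \<in> J \<Longrightarrow> i * j \<in> M" "\<And>a b. a \<in> M \<Longrightarrow> b \<in> M \<Longrightarrow> a + b \<in> M"
  shows "I \<star> J \<subseteq> M"
proof
  fix s assume "s \<in> I \<star> J"
  thus "s \<in> M" by (induction rule: ideal_prod.induct) (use assms in auto)
qed

lemma span_prod_commute: "I \<star> J = J \<star> I"
proof -
  have "I \<star> J \<subseteq> J \<star> I" for I J
  proof (rule span_prod_least)
    fix i j assume "i \<in> I" "j \<in> J"
    thus "i * j \<in> J \<star> I" using span_prod_mult[of j J i I] by (simp add: mult.commute)
  qed (rule span_prod_add)
  thus ?thesis by blast
qed

lemma span_prod_assoc: "(I \<star> J) \<star> L = I \<star> (J \<star> L)"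
proof -
  have *: "(I \<star> J) \<star> L \<subseteq> I \<star> (J \<star> L)" for I J L
  proof (rule span_prod_least)
    fix s l assume "s \<in> I \<star> J" "l \<in> L"
    have "I \<star> J \<subseteq> {s. s * l \<in> I \<star> (J \<star> L)}"
    proof (rule span_prod_least)
      fix i j assume "i \<in> I" "j \<in> J"
      thus "i * j \<in> {s. s * l \<in> I \<star> (J \<star> L)}"
        using \<open>l \<in> L\<close> by (simp add: mult.assoc span_prod_mult)
    qed (simp add: distrib_right span_prod_add)
    thus "s * l \<in> I \<star> (J \<star> L)" using \<open>s \<in> I \<star> J\<close> by blast
  qed (rule span_prod_add)
  have "I \<star> (J \<star> L) = (L \<star> J) \<star> I" by (simp only: span_prod_commute)
  also have "\<dots> \<subseteq> L \<star> (J \<star> I)" by (rule *)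
  also have "\<dots> = (I \<star> J) \<star> L" by (simp only: span_prod_commute)
  finally show ?thesis using * by blast
qed

lemma span_prod_left_commute: "I \<star> (J \<star> L) = J \<star> (I \<star> L)"
  by (metis span_prod_assoc span_prod_commute)

lemma span_prod_image:
  assumes "\<And>a b. f (a + b) = f a + f b" "\<And>i j. i \<in> I \<Longrightarrow> j \<in> J \<Longrightarrow> f (i * j) = g i * h j"
  shows "f ` (I \<star> J) = (g ` I) \<star> (h ` J)"
proof
  have "I \<star> J \<subseteq> {s. f s \<in> (g ` I) \<star> (h ` J)}"
    by (rule span_prod_least) (auto simp: assms span_prod_mult span_prod_add)
  thus "f ` (I \<star> J) \<subseteq> (g ` I) \<star> (h ` J)" by blast
  show "(g ` I) \<star> (h ` J) \<subseteq> f ` (I \<star> J)"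
  proof (rule span_prod_least)
    fix i j assume "i \<in> g ` I" "j \<in> h ` J"
    thus "i * j \<in> f ` (I \<star> J)" by (auto simp flip: assms(2) intro: span_prod_mult)
  next
    fix a b assume "a \<in> f ` (I \<star> J)" "b \<in> f ` (I \<star> J)"
    thus "a + b \<in> f ` (I \<star> J)" by (auto simp flip: assms(1) intro: span_prod_add)
  qed
qed

lemma scale_span_prod: "(c \<bullet> I) \<star> J = c \<bullet> (I \<star> J)"
  using span_prod_image[of "\<lambda>z. c * z" I J "\<lambda>z. c * z" "\<lambda>z. z"] by (simp add: algebra_simps)

lemma cnj_span_prod: "cnj ` (I \<star> J) = (cnj ` I) \<star> (cnj ` J)"
  by (rule span_prod_image) simp_all

lemma scale_scale: "a \<bullet> b \<bullet> J = (a * b) \<bullet> J"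
  by (simp add: image_image mult.assoc)

text \<open>
  Closure under negation follows from multiplication by \<open>-1 \<in> R\<close>.
\<close>

lemma ideal_complex_subring_iff:
  assumes "ring (complex_ring\<lparr>carrier := R\<rparr>)"
  shows "ideal I (complex_ring\<lparr>carrier := R\<rparr>) \<longleftrightarrow> I \<subseteq> R \<and> 0 \<in> I \<and> (\<forall>a\<in>I. \<forall>b\<in>I. a + b \<in> I) \<and> (\<forall>r\<in>R. \<forall>a\<in>I. r * a \<in> I)"
proof
  let ?R = "complex_ring\<lparr>carrier := R\<rparr>"
  assume "ideal I ?R"
  then interpret ideal I ?R .
  show "I \<subseteq> R \<and> 0 \<in> I \<and> (\<forall>a\<in>I. \<forall>b\<in>I. a + b \<in> I) \<and> (\<forall>r\<in>R. \<forall>a\<in>I. r * a \<in> I)"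
    using a_subset additive_subgroup.zero_closed[OF is_additive_subgroup]
      additive_subgroup.a_closed[OF is_additive_subgroup] I_l_closed by auto
next
  let ?R = "complex_ring\<lparr>carrier := R\<rparr>"
  interpret ring ?R by fact
  assume I: "I \<subseteq> R \<and> 0 \<in> I \<and> (\<forall>a\<in>I. \<forall>b\<in>I. a + b \<in> I) \<and> (\<forall>r\<in>R. \<forall>a\<in>I. r * a \<in> I)"
  have "1 \<in> R" using one_closed by simp
  have minus: "\<ominus>\<^bsub>?R\<^esub> a = - a \<and> - a \<in> R" if "a \<in> R" for a
  proof -
    have "a + \<ominus>\<^bsub>?R\<^esub> a = 0" using r_neg[of a] that by simp
    hence "\<ominus>\<^bsub>?R\<^esub> a = - a" by (simp add: add_eq_0_iff)
    moreover have "\<ominus>\<^bsub>?R\<^esub> a \<in> R" using a_inv_closed[of a] that by simp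
    ultimately show ?thesis by simp
  qed
  show "ideal I ?R"
  proof (rule idealI)
    show "ring ?R" by fact
    show "subgroup I (add_monoid ?R)"
    proof (rule add.subgroupI)
      fix a assume "a \<in> I"
      hence "(-1) * a \<in> I" using I minus[OF \<open>1 \<in> R\<close>] by blast
      thus "\<ominus>\<^bsub>?R\<^esub> a \<in> I" using I \<open>a \<in> I\<close> minus[of a] by auto
    qed (use I in auto)
    show "a \<otimes>\<^bsub>?R\<^esub> r \<in> I" if "a \<in> I" "r \<in> carrier ?R" for a r
      using I that by (simp add: mult.commute[of a r])
  qed (use I in auto)
qed

section \<open>The ring of integers of an imaginary quadratic field\<close>

text \<open>
  The subfields with these properties are \<open>\<rat>\<close> and the imaginary quadratic fields: a real element
  \<open>a\<close> is rational, because \<open>2 a\<close> is a trace, so the field has degree at most 2 over \<open>\<rat>\<close>.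
\<close>

locale imaginary_quadratic =
  fixes K :: "complex set"
  assumes one_mem: "1 \<in> K"
    and add_mem: "a \<in> K \<Longrightarrow> b \<in> K \<Longrightarrow> a + b \<in> K"
    and uminus_mem: "a \<in> K \<Longrightarrow> - a \<in> K"
    and mult_mem: "a \<in> K \<Longrightarrow> b \<in> K \<Longrightarrow> a * b \<in> K"
    and inverse_mem: "a \<in> K \<Longrightarrow> a \<noteq> 0 \<Longrightarrow> inverse a \<in> K"
    and cnj_mem: "a \<in> K \<Longrightarrow> cnj a \<in> K"
    and trace_rat: "a \<in> K \<Longrightarrow> a + cnj a \<in> \<rat>"
begin

abbreviation \<O> :: "complex set"
  where "\<O> \<equiv> carrier (ring_of_integers K)"

lemma zero_mem: "0 \<in> K"
  using add_mem[OF one_mem uminus_mem[OF one_mem]] by simp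

lemma norm_rat:
  assumes "a \<in> K"
  shows "a * cnj a \<in> \<rat>"
proof -
  have "a * cnj a = ((a + cnj a) * (a + cnj a) - (a * a + cnj (a * a))) / 2"
    by (simp add: algebra_simps)
  thus ?thesis using trace_rat[OF assms] trace_rat[OF mult_mem[OF assms assms]]
    by (metis Rats_diff Rats_divide Rats_mult Rats_number_of)
qed

lemma integers_iff: "a \<in> \<O> \<longleftrightarrow> a \<in> K \<and> a + cnj a \<in> \<int> \<and> a * cnj a \<in> \<int>"
proof (cases "a \<in> K")
  case True
  have "algebraic_int a \<longleftrightarrow> a + cnj a \<in> \<int> \<and> a * cnj a \<in> \<int>"
  proof
    assume a: "algebraic_int a"
    show "a + cnj a \<in> \<int> \<and> a * cnj a \<in> \<int>"
    proof (cases "Im a = 0")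
      case False
      thus ?thesis using nonreal_algebraic_int_monic[OF a False trace_rat norm_rat] True by blast
    next
      case True
      hence "cnj a = a" by (simp add: complex_eq_iff)
      moreover from this have "a = (a + cnj a) / 2" by simp
      hence "a \<in> \<rat>" using trace_rat[OF \<open>a \<in> K\<close>] by (metis Rats_divide Rats_number_of)
      hence "a \<in> \<int>" using a by (rule rational_algebraic_int_is_int[rotated])
      ultimately show ?thesis by auto
    qed
  next
    assume "a + cnj a \<in> \<int> \<and> a * cnj a \<in> \<int>"
    thus "algebraic_int a"
      by (intro algebraic_int_quadratic[of a "a + cnj a" "a * cnj a"])
        (auto simp: power2_eq_square algebra_simps)
  qed
  thus ?thesis using True by (simp add: ring_of_integers_def)
qed (simp add: ring_of_integers_def)

text \<open>
  The trace \<open>e\<close> of \<open>a * cnj b\<close> and the trace \<open>e'\<close> of \<open>a * b\<close> have sum and product that are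
  integral polynomials in the traces and norms of \<open>a\<close> and \<open>b\<close>. Thus \<open>e\<close> is an algebraic integer, and
  it is rational. With the characterization by trace and norm, this yields that the integral elements
  form a ring, without the general theory of algebraic integers.
\<close>

lemma trace_mult_cnj_int:
  assumes "a \<in> \<O>" "b \<in> \<O>"
  shows "a * cnj b + cnj (a * cnj b) \<in> \<int>"
proof -
  define e e' where "e = a * cnj b + cnj a * b" and "e' = a * b + cnj a * cnj b"
  define s t M N where "s = a + cnj a" and "t = b + cnj b" and "M = a * cnj a" and "N = b * cnj b"
  have int: "s \<in> \<int>" "t \<in> \<int>" "M \<in> \<int>" "N \<in> \<int>"
    using assms by (auto simp: integers_iff s_def t_def M_def N_def)
  have "e + e' = s * t" by (simp add: e_def e'_def s_def t_def algebra_simps)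
  hence "e * (e + e') = (s * t) * e" by simp
  hence "e ^ 2 = (s * t) * e - e * e'" by (simp add: distrib_left power2_eq_square eq_diff_eq)
  moreover have "e * e' = N * (s * s - 2 * M) + M * (t * t - 2 * N)"
    by (simp add: e_def e'_def s_def t_def M_def N_def algebra_simps)
  ultimately have "e ^ 2 = (s * t) * e - (N * (s * s - 2 * M) + M * (t * t - 2 * N))"
    by simp
  hence "algebraic_int e"
    by (rule algebraic_int_quadratic) (use int in auto)
  moreover have "e \<in> \<rat>"
    using trace_rat[of "a * cnj b"] assms by (simp add: e_def integers_iff mult_mem cnj_mem)
  ultimately have "e \<in> \<int>" by (rule rational_algebraic_int_is_int)
  thus ?thesis by (simp add: e_def)
qed

lemma nat_mem: "of_nat n \<in> K"
  by (induction n) (auto simp: zero_mem one_mem add_mem)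

lemma int_integers:
  assumes "n \<in> \<int>"
  shows "n \<in> \<O>"
proof -
  obtain k where k: "n = of_int k" using assms by (auto elim: Ints_cases)
  have "of_int k \<in> K"
    by (cases k rule: int_cases2) (auto intro: nat_mem uminus_mem)
  thus ?thesis by (simp add: k integers_iff)
qed

lemma integers_cnj: "a \<in> \<O> \<Longrightarrow> cnj a \<in> \<O>"
  by (auto simp: integers_iff cnj_mem add.commute mult.commute)

lemma integers_mult:
  assumes "a \<in> \<O>" "b \<in> \<O>"
  shows "a * b \<in> \<O>"
proof -
  have "a * b + cnj (a * b) \<in> \<int>"
    using trace_mult_cnj_int[OF assms(1) integers_cnj[OF assms(2)]] by simp
  moreover have "(a * b) * cnj (a * b) = (a * cnj a) * (b * cnj b)" by simp
  ultimately show ?thesis using assms by (metis Ints_mult integers_iff mult_mem)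
qed

lemma integers_add:
  assumes "a \<in> \<O>" "b \<in> \<O>"
  shows "a + b \<in> \<O>"
proof -
  have "(a + b) + cnj (a + b) = (a + cnj a) + (b + cnj b)" by simp
  moreover have "(a + b) * cnj (a + b) = a * cnj a + b * cnj b + (a * cnj b + cnj (a * cnj b))"
    by (simp add: algebra_simps)
  ultimately show ?thesis using assms trace_mult_cnj_int[OF assms]
    by (metis Ints_add integers_iff add_mem)
qed

lemma integers_uminus: "a \<in> \<O> \<Longrightarrow> - a \<in> \<O>"
  using integers_mult[of "-1" a] int_integers[of "-1"] by simp

lemma integers_power: "a \<in> \<O> \<Longrightarrow> a ^ k \<in> \<O>"
  by (induction k) (auto simp: integers_mult int_integers)

lemma ring_ring_of_integers: "ring (ring_of_integers K)"
proof -
  interpret C: Ring.field complex_ring by (rule complex_field)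
  have "subring \<O> complex_ring"
    by (rule C.subringI) (auto simp: integers_mult integers_add integers_uminus int_integers)
  thus ?thesis using C.subring_is_ring by (simp add: ring_of_integers_def)
qed

section \<open>The group of fractional ideals\<close>

text \<open>
  This is the predicate \<open>fractional_ideal K\<close> with the ideal conditions transported from
  \<open>d \<bullet> J\<close> back to \<open>J\<close>, so that they can be used without a denominator.
\<close>

definition fractional :: "complex set \<Rightarrow> bool"
  where "fractional J \<longleftrightarrow> J \<subseteq> K \<and> 0 \<in> J \<and> (\<forall>a\<in>J. \<forall>b\<in>J. a + b \<in> J) \<and> (\<forall>r\<in>\<O>. \<forall>a\<in>J. r * a \<in> J) \<and>
    (\<exists>d\<in>\<O> - {0}. d \<bullet> J \<subseteq> \<O>)"

lemma fractional_ideal_iff: "fractional_ideal K J \<longleftrightarrow> fractional J"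
proof -
  have R: "ring_of_integers K = complex_ring\<lparr>carrier := \<O>\<rparr>" by (simp add: ring_of_integers_def)
  have "ideal (d \<bullet> J) (ring_of_integers K) \<longleftrightarrow> d \<bullet> J \<subseteq> \<O> \<and> 0 \<in> J \<and> (\<forall>a\<in>J. \<forall>b\<in>J. a + b \<in> J) \<and>
      (\<forall>r\<in>\<O>. \<forall>a\<in>J. r * a \<in> J)" if "d \<noteq> 0" for d
  proof -
    have mem: "d * z \<in> d \<bullet> J \<longleftrightarrow> z \<in> J" for z using that by auto
    have "0 \<in> d \<bullet> J \<longleftrightarrow> 0 \<in> J" using mem[of 0] by simp
    moreover have "(\<forall>a\<in>d \<bullet> J. \<forall>b\<in>d \<bullet> J. a + b \<in> d \<bullet> J) \<longleftrightarrow> (\<forall>a\<in>J. \<forall>b\<in>J. a + b \<in> J)"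
      by (simp only: ball_simps distrib_left[symmetric] mem)
    moreover have "(\<forall>r\<in>\<O>. \<forall>a\<in>d \<bullet> J. r * a \<in> d \<bullet> J) \<longleftrightarrow> (\<forall>r\<in>\<O>. \<forall>a\<in>J. r * a \<in> J)"
      by (simp only: ball_simps mult.left_commute[of _ d] mem)
    ultimately show ?thesis
      using ideal_complex_subring_iff[of \<O> "d \<bullet> J"] ring_ring_of_integers unfolding R[symmetric] by simp
  qed
  thus ?thesis unfolding fractional_ideal_def fractional_def by (metis Diff_iff insertI1 singletonD)
qed

lemma fractional_subset: "fractional J \<Longrightarrow> a \<in> J \<Longrightarrow> a \<in> K"
  by (auto simp: fractional_def)

lemma fractional_add: "fractional J \<Longrightarrow> a \<in> J \<Longrightarrow> b \<in> J \<Longrightarrow> a + b \<in> J"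
  by (auto simp: fractional_def)

lemma fractional_mult: "fractional J \<Longrightarrow> r \<in> \<O> \<Longrightarrow> a \<in> J \<Longrightarrow> r * a \<in> J"
  by (auto simp: fractional_def)

lemma fractional_nonzero: "fractional J \<Longrightarrow> J \<noteq> {0} \<Longrightarrow> \<exists>a\<in>J. a \<noteq> 0"
  unfolding fractional_def by blast

lemma integers_span_prod:
  assumes "fractional J"
  shows "\<O> \<star> J = J"
proof
  show "\<O> \<star> J \<subseteq> J"
    by (rule span_prod_least) (auto intro: fractional_mult[OF assms] fractional_add[OF assms])
  show "J \<subseteq> \<O> \<star> J"
  proof
    fix a assume "a \<in> J"
    thus "a \<in> \<O> \<star> J" using span_prod_mult[of 1 \<O> a J] int_integers[of 1] by simp
  qed
qed

lemma fractional_integers: "fractional \<O>"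
proof -
  have "\<O> \<subseteq> K" using integers_iff by blast
  moreover have "1 \<in> \<O> - {0}" "0 \<in> \<O>" using int_integers by simp_all
  moreover have "1 \<bullet> \<O> \<subseteq> \<O>" by simp
  ultimately show ?thesis unfolding fractional_def
    by (intro conjI ballI bexI[of _ 1] integers_add integers_mult)
qed

text \<open>
  The product of denominators of the trace and of the norm clears both of them.
\<close>

lemma common_denominator:
  assumes "c \<in> K"
  obtains d where "d \<in> \<O>" "d \<noteq> 0" "d * c \<in> \<O>"
proof -
  obtain m n where mn: "n > 0" "c + cnj c = of_int m / of_int n"
    using trace_rat[OF assms] by (auto elim: Rats_cases')
  obtain k l where kl: "l > 0" "c * cnj c = of_int k / of_int l"
    using norm_rat[OF assms] by (auto elim: Rats_cases')
  define d :: complex where "d = of_int (n * l)"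
  have "d \<in> \<int>" by (simp add: d_def)
  hence "d \<in> \<O>" by (rule int_integers)
  moreover have "cnj d = d" by (simp add: d_def)
  moreover have "d * (c + cnj c) = of_int (m * l)" "d * d * (c * cnj c) = of_int (k * l * n * n)"
    using mn kl by (simp_all add: d_def)
  hence "d * (c + cnj c) \<in> \<int>" "d * d * (c * cnj c) \<in> \<int>" by (simp_all only: Ints_of_int)
  ultimately have "d * c \<in> K" "d * c + cnj (d * c) \<in> \<int>" "(d * c) * cnj (d * c) \<in> \<int>"
    using assms by (simp_all add: integers_iff mult_mem distrib_left mult_ac)
  hence "d * c \<in> \<O>" by (simp only: integers_iff)
  moreover have "d \<noteq> 0" using mn kl by (simp add: d_def)
  ultimately show ?thesis using that \<open>d \<in> \<O>\<close> by blast
qed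

lemma fractional_scale:
  assumes "fractional J" "c \<in> K"
  shows "fractional (c \<bullet> J)"
proof -
  obtain d where d: "d \<in> \<O>" "d \<noteq> 0" "d \<bullet> J \<subseteq> \<O>" using assms(1) by (auto simp: fractional_def)
  obtain e where e: "e \<in> \<O>" "e \<noteq> 0" "e * c \<in> \<O>" using common_denominator[OF assms(2)] .
  have "(e * d) \<bullet> c \<bullet> J \<subseteq> \<O>"
  proof (clarsimp)
    fix a assume "a \<in> J"
    hence "(e * c) * (d * a) \<in> \<O>" using d e by (intro integers_mult[of "e * c" "d * a"]) auto
    thus "e * d * (c * a) \<in> \<O>" by (simp add: mult_ac)
  qed
  moreover have "e * d \<in> \<O> - {0}" using d e by (simp add: integers_mult)
  ultimately have "\<exists>d\<in>\<O> - {0}. d \<bullet> c \<bullet> J \<subseteq> \<O>" by blast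
  moreover have "0 \<in> J" using assms(1) by (simp add: fractional_def)
  hence "0 \<in> c \<bullet> J" by force
  moreover have "c * a + c * b \<in> c \<bullet> J" if "a \<in> J" "b \<in> J" for a b
    using imageI[OF fractional_add[OF assms(1) that], of "\<lambda>z. c * z"] by (simp add: distrib_left)
  moreover have "r * (c * a) \<in> c \<bullet> J" if "r \<in> \<O>" "a \<in> J" for r a
    using imageI[OF fractional_mult[OF assms(1) that], of "\<lambda>z. c * z"] by (simp add: mult.left_commute[of r c])
  moreover have "c \<bullet> J \<subseteq> K" using assms by (auto simp: fractional_def mult_mem)
  ultimately show ?thesis unfolding fractional_def by blast
qed

lemma fractional_cnj:
  assumes "fractional J"
  shows "fractional (cnj ` J)"
proof -
  obtain d where d: "d \<in> \<O>" "d \<noteq> 0" "d \<bullet> J \<subseteq> \<O>" using assms by (auto simp: fractional_def)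
  have "cnj d * cnj a \<in> \<O>" if "a \<in> J" for a
    using integers_cnj[of "d * a"] d that by auto
  hence "cnj d \<bullet> cnj ` J \<subseteq> \<O>" by auto
  hence "\<exists>d\<in>\<O> - {0}. d \<bullet> cnj ` J \<subseteq> \<O>" using d integers_cnj by force
  moreover have "0 \<in> J" using assms by (simp add: fractional_def)
  hence "0 \<in> cnj ` J" by force
  moreover have "cnj a + cnj b \<in> cnj ` J" if "a \<in> J" "b \<in> J" for a b
    using imageI[OF fractional_add[OF assms that], of cnj] by simp
  moreover have "r * cnj a \<in> cnj ` J" if "r \<in> \<O>" "a \<in> J" for r a
  proof -
    have "r * cnj a = cnj (cnj r * a)" by simp
    thus ?thesis using fractional_mult[OF assms integers_cnj[OF that(1)] that(2)] by blast
  qed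
  moreover have "cnj ` J \<subseteq> K" using assms by (auto simp: fractional_def cnj_mem)
  ultimately show ?thesis unfolding fractional_def by blast
qed

lemma fractional_span_prod:
  assumes "fractional I" "fractional J"
  shows "fractional (I \<star> J)"
proof -
  obtain d where d: "d \<in> \<O>" "d \<noteq> 0" "d \<bullet> I \<subseteq> \<O>" using assms(1) by (auto simp: fractional_def)
  obtain e where e: "e \<in> \<O>" "e \<noteq> 0" "e \<bullet> J \<subseteq> \<O>" using assms(2) by (auto simp: fractional_def)
  have "I \<star> J \<subseteq> {s \<in> K. (d * e) * s \<in> \<O>}"
  proof (rule span_prod_least)
    fix i j assume ij: "i \<in> I" "j \<in> J"
    hence "(d * i) * (e * j) \<in> \<O>" using d e by (intro integers_mult[of "d * i" "e * j"]) auto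
    thus "i * j \<in> {s \<in> K. (d * e) * s \<in> \<O>}"
      using ij fractional_subset assms by (simp add: mult_ac mult_mem)
  qed (auto simp: distrib_left integers_add add_mem)
  hence "I \<star> J \<subseteq> K" "(d * e) \<bullet> (I \<star> J) \<subseteq> \<O>" by auto
  moreover have "d * e \<in> \<O> - {0}" using d e by (simp add: integers_mult)
  ultimately have sub: "I \<star> J \<subseteq> K" "\<exists>d\<in>\<O> - {0}. d \<bullet> (I \<star> J) \<subseteq> \<O>" by - (assumption, rule bexI)
  have "0 * 0 \<in> I \<star> J" using assms by (intro span_prod_mult) (auto simp: fractional_def)
  hence zero: "0 \<in> I \<star> J" by simp
  have mult: "r * s \<in> I \<star> J" if "r \<in> \<O>" "s \<in> I \<star> J" for r s
  proof -
    have "r * s \<in> \<O> \<star> (I \<star> J)" using that by (rule span_prod_mult)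
    also have "\<dots> = I \<star> J" by (simp only: span_prod_assoc[symmetric] integers_span_prod[OF assms(1)])
    finally show ?thesis .
  qed
  show ?thesis unfolding fractional_def
    by (intro conjI ballI sub zero mult span_prod_add)
qed

text \<open>
  Invertibility of ideals comes from conjugation. Let \<open>g\<close> be the positive generator of the
  integers in \<open>P = J \<star> cnj ` J\<close>. For \<open>a, b \<in> J\<close>, the trace of \<open>a * cnj b\<close> and the norms of
  \<open>a\<close> and \<open>b\<close> are integers in \<open>P\<close>, so they are divisible by \<open>g\<close>. Hence the quotient of \<open>a * cnj b\<close> by \<open>g\<close> has
  integral trace and norm, which makes it integral, and \<open>P = g \<bullet> \<O>\<close>.
\<close>

lemma integral_mult_cnj:
  assumes J: "fractional J" "J \<subseteq> \<O>" "J \<noteq> {0}"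
  obtains g where "g \<in> \<int>" "g \<noteq> 0" "J \<star> cnj ` J = g \<bullet> \<O>"
proof -
  define P where "P = J \<star> cnj ` J"
  have P: "fractional P" unfolding P_def using J(1) by (intro fractional_span_prod fractional_cnj)
  define Z where "Z = {m :: int. of_int m \<in> P}"
  have Z_minus: "- m \<in> Z" if "m \<in> Z" for m
    using fractional_mult[OF P, of "-1" "of_int m"] that int_integers[of "-1"] by (simp add: Z_def)
  have Z_add: "a + b \<in> Z" if "a \<in> Z" "b \<in> Z" for a b
    using fractional_add[OF P] that by (simp add: Z_def)
  have Z_mult: "k * m \<in> Z" if "m \<in> Z" for k m
    using fractional_mult[OF P, of "of_int k" "of_int m"] that int_integers by (simp add: Z_def)
  have norm_mem: "a * cnj a \<in> P" if "a \<in> J" for a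
    unfolding P_def using that by (intro span_prod_mult) auto
  have trace_mem: "a * cnj b + cnj (a * cnj b) \<in> P" if "a \<in> J" "b \<in> J" for a b
  proof -
    have "a * cnj b \<in> P" "b * cnj a \<in> P"
      unfolding P_def using that by (auto intro: span_prod_mult)
    thus ?thesis using fractional_add[OF P] by (simp add: mult.commute)
  qed
  obtain a where a: "a \<in> J" "a \<noteq> 0" using fractional_nonzero[OF J(1,3)] by blast
  have "a * cnj a \<in> \<int>" using a(1) J(2) integers_iff by blast
  then obtain m where m: "a * cnj a = of_int m" by (elim Ints_cases)
  have "m \<in> Z" using norm_mem[OF a(1)] unfolding m by (simp add: Z_def)
  have "of_int m \<noteq> (0 :: complex)" using a(2) by (simp flip: m)
  hence "m \<noteq> 0" by simp
  define g where "g = (LEAST k. k > 0 \<and> int k \<in> Z)"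
  have "\<bar>m\<bar> \<in> Z" using \<open>m \<in> Z\<close> Z_minus[of m] by (simp add: abs_if)
  hence "nat \<bar>m\<bar> > 0 \<and> int (nat \<bar>m\<bar>) \<in> Z" using \<open>m \<noteq> 0\<close> by simp
  hence g: "g > 0 \<and> int g \<in> Z" unfolding g_def
    by (rule LeastI[of "\<lambda>k. k > 0 \<and> int k \<in> Z"])
  have g_dvd: "int g dvd k" if "k \<in> Z" for k
  proof (rule ccontr)
    assume "\<not> int g dvd k"
    define r where "r = k mod int g"
    have "r \<noteq> 0" using \<open>\<not> int g dvd k\<close> by (simp add: r_def dvd_eq_mod_eq_0)
    moreover have "0 \<le> r" "r < int g" using g by (simp_all add: r_def)
    ultimately have r: "0 < r" "r < int g" by simp_all
    have "r = k + (- (k div int g)) * int g" by (simp add: r_def minus_div_mult_eq_mod[symmetric])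
    hence "r \<in> Z" using Z_add[OF that Z_mult] g by metis
    hence "nat r > 0 \<and> int (nat r) \<in> Z" using r by simp
    hence "g \<le> nat r" unfolding g_def
      by (rule Least_le[of "\<lambda>k. k > 0 \<and> int k \<in> Z"])
    thus False using r by linarith
  qed
  have div: "s / of_nat g \<in> \<int>" if "s \<in> \<int>" "s \<in> P" for s
  proof -
    obtain k where k: "s = of_int k" using \<open>s \<in> \<int>\<close> by (auto elim: Ints_cases)
    hence "int g dvd k" using that(2) g_dvd by (simp add: Z_def)
    thus ?thesis using g k by (auto elim!: dvdE)
  qed
  have "P \<subseteq> of_nat g \<bullet> \<O>"
    unfolding P_def
  proof (rule span_prod_least)
    fix a b' assume "a \<in> J" "b' \<in> cnj ` J"
    then obtain b where b: "b \<in> J" "b' = cnj b" by blast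
    define z where "z = a * b' / of_nat g"
    have "a \<in> \<O>" "b \<in> \<O>" using \<open>a \<in> J\<close> b J(2) by auto
    have "inverse (of_nat g) \<in> K" using int_integers[of "of_nat g"] g
      by (intro inverse_mem) (auto simp: integers_iff)
    hence "z \<in> K" using \<open>a \<in> \<O>\<close> \<open>b \<in> \<O>\<close> by (simp add: z_def b(2) divide_inverse mult_mem cnj_mem integers_iff)
    moreover have "z + cnj z = (a * cnj b + cnj (a * cnj b)) / of_nat g"
      by (simp add: z_def b(2) add_divide_distrib)
    hence "z + cnj z \<in> \<int>"
      using div[OF trace_mult_cnj_int[OF \<open>a \<in> \<O>\<close> \<open>b \<in> \<O>\<close>] trace_mem[OF \<open>a \<in> J\<close> b(1)]] by simp
    moreover have "z * cnj z = (a * cnj a / of_nat g) * (b * cnj b / of_nat g)"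
      by (simp add: z_def b(2))
    hence "z * cnj z \<in> \<int>"
      using div[OF _ norm_mem[OF \<open>a \<in> J\<close>]] div[OF _ norm_mem[OF b(1)]] \<open>a \<in> \<O>\<close> \<open>b \<in> \<O>\<close>
      by (metis Ints_mult integers_iff)
    ultimately have "z \<in> \<O>" by (simp add: integers_iff)
    moreover have "a * b' = of_nat g * z" using g by (simp add: z_def)
    ultimately show "a * b' \<in> of_nat g \<bullet> \<O>" by blast
  next
    fix a b assume "a \<in> of_nat g \<bullet> \<O>" "b \<in> of_nat g \<bullet> \<O>"
    thus "a + b \<in> of_nat g \<bullet> \<O>" by (auto simp flip: distrib_left intro: integers_add)
  qed
  moreover have "of_nat g \<bullet> \<O> \<subseteq> P"
    using g fractional_mult[OF P] by (auto simp: Z_def mult.commute[of "of_nat g"])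
  ultimately show ?thesis
    using that[of "of_nat g"] g by (simp add: P_def)
qed

text \<open>
  Scaling by a denominator \<open>d\<close> makes \<open>J\<close> integral; with \<open>g\<close> from \<open>integral_mult_cnj\<close> for
  \<open>d \<bullet> J\<close>, the inverse is \<open>(d / g) \<bullet> cnj ` (d \<bullet> J)\<close>.
\<close>

lemma fractional_inverse:
  assumes J: "fractional J" "J \<noteq> {0}"
  obtains L where "fractional L" "L \<noteq> {0}" "L \<star> J = \<O>"
proof -
  obtain d where d: "d \<in> \<O>" "d \<noteq> 0" "d \<bullet> J \<subseteq> \<O>" using J(1) by (auto simp: fractional_def)
  have dK: "d \<in> K" using d by (simp add: integers_iff)
  have fd: "fractional (d \<bullet> J)" using J dK by (rule_tac fractional_scale)
  obtain a where "a \<in> J" "a \<noteq> 0" using fractional_nonzero[OF J] by blast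
  hence "d * a \<in> d \<bullet> J" "d * a \<noteq> 0" using d by auto
  hence "d \<bullet> J \<noteq> {0}" by (metis singletonD)
  then obtain g where g: "g \<in> \<int>" "g \<noteq> 0" "(d \<bullet> J) \<star> cnj ` (d \<bullet> J) = g \<bullet> \<O>"
    using integral_mult_cnj[OF fd d(3)] by blast
  define L where "L = (inverse g * d) \<bullet> cnj ` (d \<bullet> J)"
  have "inverse g * d \<in> K" using g dK int_integers[of g] by (intro mult_mem inverse_mem) (auto simp: integers_iff)
  hence L: "fractional L" unfolding L_def by (intro fractional_scale fractional_cnj fd)
  have "L \<star> J = inverse g \<bullet> ((d \<bullet> J) \<star> cnj ` (d \<bullet> J))"
    unfolding L_def scale_span_prod span_prod_commute[of "cnj ` (d \<bullet> J)"] by (simp only: scale_scale)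
  also have "\<dots> = \<O>" unfolding g(3) scale_scale using g(2) by simp
  finally have LJ: "L \<star> J = \<O>" .
  have "L \<noteq> {0}"
  proof
    assume "L = {0}"
    hence "L \<star> J \<subseteq> {0}" by (intro span_prod_least) auto
    thus False using LJ int_integers[of 1] by auto
  qed
  thus ?thesis using that L LJ by blast
qed

lemma comm_group_fractional_ideal_group: "comm_group (fractional_ideal_group K)"
proof -
  have nz: "I \<star> J \<noteq> {0}" if IJ: "fractional I" "fractional J" "I \<noteq> {0}" "J \<noteq> {0}" for I J
  proof -
    obtain i j where "i \<in> I" "i \<noteq> 0" "j \<in> J" "j \<noteq> 0"
      using fractional_nonzero[OF IJ(1,3)] fractional_nonzero[OF IJ(2,4)] by blast
    hence "i * j \<in> I \<star> J" "i * j \<noteq> 0" by (auto intro: span_prod_mult)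
    thus ?thesis by (metis singletonD)
  qed
  have carrier: "J \<in> carrier (fractional_ideal_group K) \<longleftrightarrow> fractional J \<and> J \<noteq> {0}" for J
    by (simp add: fractional_ideal_group_def fractional_ideal_iff)
  have mult: "I \<otimes>\<^bsub>fractional_ideal_group K\<^esub> J = I \<star> J" for I J
    by (simp add: fractional_ideal_group_def)
  have one: "\<one>\<^bsub>fractional_ideal_group K\<^esub> = \<O>"
    by (simp add: fractional_ideal_group_def)
  show ?thesis
  proof (rule comm_groupI, unfold carrier mult one)
    show "fractional \<O> \<and> \<O> \<noteq> {0}"
      using fractional_integers int_integers[of 1] by auto
    show "\<exists>L\<in>carrier (fractional_ideal_group K). L \<star> J = \<O>" if J: "fractional J \<and> J \<noteq> {0}" for J
    proof -
      obtain L where "fractional L" "L \<noteq> {0}" "L \<star> J = \<O>" using fractional_inverse J by blast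
      thus ?thesis using carrier by blast
    qed
    show "I \<star> J = J \<star> I" for I J by (rule span_prod_commute)
    show "I \<star> J \<star> L = I \<star> (J \<star> L)" for I J L by (rule span_prod_assoc)
  qed (use fractional_span_prod nz integers_span_prod in blast)+
qed

section \<open>Principal fractional ideals\<close>

lemma principal_span_prod: "(a \<bullet> \<O>) \<star> (b \<bullet> \<O>) = (a * b) \<bullet> \<O>"
proof -
  have "(a \<bullet> \<O>) \<star> (b \<bullet> \<O>) = a \<bullet> ((b \<bullet> \<O>) \<star> \<O>)"
    by (simp only: scale_span_prod span_prod_commute[of \<O> "b \<bullet> \<O>"])
  also have "\<dots> = (a * b) \<bullet> \<O>"
    by (simp only: scale_span_prod scale_scale integers_span_prod[OF fractional_integers])
  finally show ?thesis .
qed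

lemma scale_integers_mem: "c \<in> c \<bullet> \<O>"
  using imageI[OF int_integers[OF Ints_1], of "\<lambda>z. c * z"] by simp

lemma principal_in_carrier:
  assumes "c \<in> K" "c \<noteq> 0"
  shows "c \<bullet> \<O> \<in> carrier (fractional_ideal_group K)"
proof -
  have "c \<bullet> \<O> \<noteq> {0}" using scale_integers_mem[of c] assms(2) by (metis singletonD)
  thus ?thesis using fractional_scale[OF fractional_integers assms(1)]
    by (simp add: fractional_ideal_group_def fractional_ideal_iff)
qed

lemma subgroup_principal: "subgroup (principal_fractional_ideals K) (fractional_ideal_group K)"
proof -
  interpret comm_group "fractional_ideal_group K" by (rule comm_group_fractional_ideal_group)
  have mult: "I \<otimes>\<^bsub>fractional_ideal_group K\<^esub> J = I \<star> J" for I J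
    by (simp add: fractional_ideal_group_def)
  have one: "\<one>\<^bsub>fractional_ideal_group K\<^esub> = \<O>" by (simp add: fractional_ideal_group_def)
  show ?thesis
  proof (rule subgroupI)
    show "principal_fractional_ideals K \<subseteq> carrier (fractional_ideal_group K)"
      unfolding principal_fractional_ideals_def using principal_in_carrier by blast
    show "principal_fractional_ideals K \<noteq> {}"
    proof -
      have "1 \<bullet> \<O> \<in> principal_fractional_ideals K"
        using one_mem unfolding principal_fractional_ideals_def by (intro CollectI exI[of _ 1]) simp
      thus ?thesis by (metis empty_iff)
    qed
  next
    fix I assume "I \<in> principal_fractional_ideals K"
    then obtain c where c: "c \<in> K" "c \<noteq> 0" "I = c \<bullet> \<O>"
      unfolding principal_fractional_ideals_def by blast
    have ic: "inverse c \<in> K" "inverse c \<noteq> 0" using c inverse_mem by auto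
    have "inv\<^bsub>fractional_ideal_group K\<^esub> I = inverse c \<bullet> \<O>"
      using c principal_in_carrier[OF ic] principal_in_carrier[OF c(1,2)]
      by (intro comm_inv_char) (simp_all add: mult one principal_span_prod)
    thus "inv\<^bsub>fractional_ideal_group K\<^esub> I \<in> principal_fractional_ideals K"
      using ic unfolding principal_fractional_ideals_def by blast
  next
    fix I J assume "I \<in> principal_fractional_ideals K" "J \<in> principal_fractional_ideals K"
    then obtain a b where "a \<in> K" "a \<noteq> 0" "I = a \<bullet> \<O>" "b \<in> K" "b \<noteq> 0" "J = b \<bullet> \<O>"
      unfolding principal_fractional_ideals_def by blast
    hence "I \<star> J = (a * b) \<bullet> \<O>" "a * b \<in> K - {0}" by (simp_all add: principal_span_prod mult_mem)
    thus "I \<otimes>\<^bsub>fractional_ideal_group K\<^esub> J \<in> principal_fractional_ideals K"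
      unfolding mult principal_fractional_ideals_def by blast
  qed
qed

lemma principal_power:
  assumes "c \<in> K" "c \<noteq> 0"
  shows "(c \<bullet> \<O>) [^]\<^bsub>fractional_ideal_group K\<^esub> (k::nat) = c ^ k \<bullet> \<O>"
proof (induction k)
  case 0
  show ?case by (simp add: fractional_ideal_group_def)
next
  case (Suc k)
  interpret comm_group "fractional_ideal_group K" by (rule comm_group_fractional_ideal_group)
  have "(c \<bullet> \<O>) [^]\<^bsub>fractional_ideal_group K\<^esub> Suc k = (c ^ k \<bullet> \<O>) \<star> (c \<bullet> \<O>)"
    using Suc by (simp add: fractional_ideal_group_def)
  also have "\<dots> = c ^ Suc k \<bullet> \<O>"
    by (simp only: principal_span_prod power_Suc2)
  finally show ?case .
qed

lemma norm_int_nonneg: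
  assumes "c \<in> \<O>"
  obtains N :: int where "c * cnj c = of_int N" "N \<ge> 0"
proof -
  obtain N where N: "c * cnj c = of_int N" using assms integers_iff by (metis Ints_cases)
  have "of_int N = (of_real ((norm c)\<^sup>2) :: complex)" using N by (simp only: complex_norm_square)
  hence "real_of_int N = (norm c)\<^sup>2" by (metis of_real_eq_iff of_real_of_int_eq)
  hence "N \<ge> 0" by (metis of_int_0_le_iff zero_le_power2)
  thus ?thesis using that N by blast
qed

text \<open>
  Generators of the same ideal differ by a unit, and a unit has norm one since norms are nonnegative
  integers here.
\<close>

lemma principal_eqD:
  assumes "a \<bullet> \<O> = b \<bullet> \<O>" "a \<noteq> 0"
  obtains u where "u \<in> \<O>" "u * cnj u = 1" "a = u * b"
proof -
  have "a \<in> b \<bullet> \<O>" "b \<in> a \<bullet> \<O>"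
    using scale_integers_mem[of a] scale_integers_mem[of b] assms(1) by simp_all
  obtain u where u: "u \<in> \<O>" "a = b * u" using \<open>a \<in> b \<bullet> \<O>\<close> by (rule imageE)
  obtain v where v: "v \<in> \<O>" "b = a * v" using \<open>b \<in> a \<bullet> \<O>\<close> by (rule imageE)
  have uv: "u * v = 1" using u(2) v(2) assms(2) by (metis mult.assoc mult.commute mult_cancel_left1)
  obtain i where i: "u * cnj u = of_int i" "i \<ge> 0" using norm_int_nonneg[OF u(1)] .
  obtain j where j: "v * cnj v = of_int j" "j \<ge> 0" using norm_int_nonneg[OF v(1)] .
  have "of_int (i * j) = (u * cnj u) * (v * cnj v)" by (simp add: i j)
  also have "\<dots> = (u * v) * cnj (u * v)" by (simp add: mult_ac)
  also have "\<dots> = of_int 1" using uv by simp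
  finally have "i * j = 1" by (simp only: of_int_eq_iff)
  hence "i = 1" using i(2) zmult_eq_1_iff[of i j] by auto
  thus ?thesis using that u i by (simp add: mult.commute)
qed

end

section \<open>An ideal whose \<open>n\<close>-th power is principal\<close>

text \<open>
  The element \<open>a\<close> stands for \<open>x + sqrt (x\<^sup>2 - y ^ n)\<close>, which has trace \<open>2 x\<close> and norm \<open>y ^ n\<close>.
\<close>

locale coprime_norm_power = imaginary_quadratic +
  fixes a :: complex and y n :: nat and t :: int
  assumes a_integral: "a \<in> \<O>"
    and norm_a: "a * cnj a = of_nat y ^ n"
    and trace_a: "a + cnj a = of_int t"
    and coprime_trace: "coprime t (int y)"
    and y_pos: "y > 0" and n_pos: "n > 0"
begin

definition root_ideal :: "complex set"
  where "root_ideal = {a * u + of_nat y * v | u v. u \<in> \<O> \<and> v \<in> \<O>}"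

lemma a_nonzero: "a \<noteq> 0"
  using norm_a y_pos by auto

lemma nat_integers: "of_nat k \<in> \<O>"
  by (simp add: int_integers)

lemma root_ideal_mem: "u \<in> \<O> \<Longrightarrow> v \<in> \<O> \<Longrightarrow> a * u + of_nat y * v \<in> root_ideal"
  unfolding root_ideal_def by blast

lemma generators_mem: "a \<in> root_ideal" "of_nat y \<in> root_ideal"
  using root_ideal_mem[of 1 0] root_ideal_mem[of 0 1] int_integers[of 0] int_integers[of 1] by simp_all

lemma root_ideal_subset: "root_ideal \<subseteq> \<O>"
  unfolding root_ideal_def using a_integral nat_integers by (auto intro!: integers_add integers_mult)

lemma fractional_root_ideal: "fractional root_ideal"
  unfolding fractional_def
proof (intro conjI ballI)
  show "root_ideal \<subseteq> K" using root_ideal_subset integers_iff by blast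
  show "0 \<in> root_ideal" using root_ideal_mem[of 0 0] int_integers[of 0] by simp
  show "r + s \<in> root_ideal" if rs: "r \<in> root_ideal" "s \<in> root_ideal" for r s
  proof -
    obtain u v u' v' where *: "u \<in> \<O>" "v \<in> \<O>" "u' \<in> \<O>" "v' \<in> \<O>"
      "r = a * u + of_nat y * v" "s = a * u' + of_nat y * v'"
      using rs unfolding root_ideal_def by blast
    have "r + s = a * (u + u') + of_nat y * (v + v')" using * by (simp add: algebra_simps)
    thus ?thesis using root_ideal_mem integers_add * by metis
  qed
  show "r * s \<in> root_ideal" if rs: "r \<in> \<O>" "s \<in> root_ideal" for r s
  proof -
    obtain u v where *: "u \<in> \<O>" "v \<in> \<O>" "s = a * u + of_nat y * v"
      using rs unfolding root_ideal_def by blast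
    have "r * s = a * (r * u) + of_nat y * (r * v)" using * by (simp add: algebra_simps)
    thus ?thesis using root_ideal_mem integers_mult * rs by metis
  qed
  show "\<exists>d\<in>\<O> - {0}. d \<bullet> root_ideal \<subseteq> \<O>"
    using root_ideal_subset int_integers[of 1] by (intro bexI[of _ 1]) simp_all
qed

lemma root_ideal_carrier: "root_ideal \<in> carrier (fractional_ideal_group K)"
proof -
  have "root_ideal \<noteq> {0}" using generators_mem a_nonzero by (metis singletonD)
  thus ?thesis using fractional_root_ideal by (simp add: fractional_ideal_group_def fractional_ideal_iff)
qed

text \<open>
  The product is generated by \<open>a * cnj a = y ^ n\<close>, \<open>a * y\<close>, \<open>cnj a * y\<close> and \<open>y\<^sup>2\<close>, all of
  which are multiples of \<open>y\<close>. Conversely it contains \<open>t * y\<close> and \<open>y\<^sup>2\<close>, hence \<open>y\<close> by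
  coprimality.
\<close>

lemma root_ideal_norm: "root_ideal \<star> cnj ` root_ideal = of_nat y \<bullet> \<O>"
proof
  show "root_ideal \<star> cnj ` root_ideal \<subseteq> of_nat y \<bullet> \<O>"
  proof (rule span_prod_least)
    fix r s assume "r \<in> root_ideal" "s \<in> cnj ` root_ideal"
    then obtain u v u' v' where *: "u \<in> \<O>" "v \<in> \<O>" "u' \<in> \<O>" "v' \<in> \<O>"
      "r = a * u + of_nat y * v" "s = cnj (a * u' + of_nat y * v')"
      unfolding root_ideal_def by blast
    have "r * s = (a * cnj a) * (u * cnj u')
        + of_nat y * (a * u * cnj v' + cnj a * cnj u' * v + of_nat y * v * cnj v')"
      using * by (simp add: algebra_simps)
    also have "a * cnj a = of_nat y * of_nat y ^ (n - 1)"
      unfolding norm_a using n_pos by (simp flip: power_Suc)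
    finally have "r * s = of_nat y * (of_nat y ^ (n - 1) * (u * cnj u')
        + (a * u * cnj v' + cnj a * cnj u' * v + of_nat y * v * cnj v'))"
      by (simp only: distrib_left mult.assoc)
    moreover have "of_nat y ^ (n - 1) * (u * cnj u')
        + (a * u * cnj v' + cnj a * cnj u' * v + of_nat y * v * cnj v') \<in> \<O>"
      by (intro integers_add integers_mult integers_power integers_cnj nat_integers a_integral *)
    ultimately show "r * s \<in> of_nat y \<bullet> \<O>" by (rule image_eqI)
  next
    fix r s assume "r \<in> of_nat y \<bullet> \<O>" "s \<in> of_nat y \<bullet> \<O>"
    then obtain u v where "u \<in> \<O>" "v \<in> \<O>" "r = of_nat y * u" "s = of_nat y * v" by blast
    hence "r + s = of_nat y * (u + v)" "u + v \<in> \<O>" by (simp_all add: distrib_left integers_add)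
    thus "r + s \<in> of_nat y \<bullet> \<O>" by (rule image_eqI)
  qed
  let ?P = "root_ideal \<star> cnj ` root_ideal"
  have P: "fractional ?P" by (intro fractional_span_prod fractional_cnj fractional_root_ideal)
  have "cnj a \<in> cnj ` root_ideal" "of_nat y \<in> cnj ` root_ideal"
    using imageI[OF generators_mem(1), of cnj] imageI[OF generators_mem(2), of cnj] by simp_all
  hence mem: "a * of_nat y \<in> ?P" "of_nat y * cnj a \<in> ?P" "of_nat y * of_nat y \<in> ?P"
    using generators_mem by (auto intro: span_prod_mult)
  obtain i j where "i * t + j * int y = 1"
    using coprime_trace bezout_int[of t "int y"] by auto
  hence ij: "of_int (i * t + j * int y) = (1 :: complex)" by simp
  have "of_nat y = of_int (i * t + j * int y) * (of_nat y :: complex)"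
    unfolding ij by simp
  also have "\<dots> = of_int i * (a * of_nat y + of_nat y * cnj a) + of_int j * (of_nat y * of_nat y)"
    by (simp add: algebra_simps flip: trace_a)
  also have "\<dots> \<in> ?P"
    by (rule fractional_add[OF P fractional_mult[OF P _ fractional_add[OF P mem(1,2)]]
          fractional_mult[OF P _ mem(3)]]) (simp_all add: int_integers)
  finally have y: "of_nat y \<in> ?P" .
  show "of_nat y \<bullet> \<O> \<subseteq> ?P"
  proof
    fix r assume "r \<in> of_nat y \<bullet> \<O>"
    then obtain u where "u \<in> \<O>" "r = u * of_nat y" by (auto simp: mult.commute)
    thus "r \<in> ?P" using fractional_mult[OF P _ y] by simp
  qed
qed

abbreviation root_power :: "nat \<Rightarrow> complex set"
  where "root_power k \<equiv> root_ideal [^]\<^bsub>fractional_ideal_group K\<^esub> k"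

lemma root_power_0: "root_power 0 = \<O>"
  by (simp add: fractional_ideal_group_def)

lemma root_power_Suc: "root_power (Suc k) = root_power k \<star> root_ideal"
  by (simp add: fractional_ideal_group_def nat_pow_def)

lemma fractional_root_power: "fractional (root_power k)"
  by (induction k) (simp_all only: root_power_0 root_power_Suc fractional_integers fractional_span_prod fractional_root_ideal)

lemma root_power_norm: "root_power k \<star> cnj ` root_power k = of_nat y ^ k \<bullet> \<O>"
proof (induction k)
  case 0
  have "cnj ` \<O> = \<O>"
  proof
    show "cnj ` \<O> \<subseteq> \<O>" using integers_cnj by blast
    show "\<O> \<subseteq> cnj ` \<O>" using integers_cnj by (metis complex_cnj_cnj image_eqI subsetI)
  qed
  thus ?case unfolding root_power_0 by (simp add: integers_span_prod fractional_integers)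
next
  case (Suc k)
  have "root_power (Suc k) \<star> cnj ` root_power (Suc k)
      = (root_power k \<star> root_ideal) \<star> (cnj ` root_power k \<star> cnj ` root_ideal)"
    by (simp only: root_power_Suc cnj_span_prod)
  also have "\<dots> = (root_power k \<star> cnj ` root_power k) \<star> (root_ideal \<star> cnj ` root_ideal)"
    by (simp only: span_prod_assoc span_prod_left_commute[of root_ideal])
  also have "\<dots> = of_nat y ^ Suc k \<bullet> \<O>"
    by (simp only: Suc root_ideal_norm principal_span_prod power_Suc2)
  finally show ?case .
qed

text \<open>
  In a product of \<open>k\<close> elements of \<open>root_ideal\<close>, all terms but the one with \<open>y ^ k\<close> contain the factor \<open>a\<close>.
\<close>

lemma root_power_subset: "root_power k \<subseteq> {a * u + of_nat y ^ k * v | u v. u \<in> \<O> \<and> v \<in> \<O>}"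
proof (induction k)
  case 0
  show ?case
  proof
    fix r assume "r \<in> root_power 0"
    hence "0 \<in> \<O> \<and> r \<in> \<O>" "r = a * 0 + of_nat y ^ 0 * r" by (simp_all only: root_power_0) (simp_all add: int_integers)
    thus "r \<in> {a * u + of_nat y ^ 0 * v | u v. u \<in> \<O> \<and> v \<in> \<O>}" by (intro CollectI exI conjI) auto
  qed
next
  case (Suc k)
  show ?case unfolding root_power_Suc
  proof (rule span_prod_least)
    fix r s assume "r \<in> root_power k" "s \<in> root_ideal"
    then obtain u v u' v' where *: "u \<in> \<O>" "v \<in> \<O>" "u' \<in> \<O>" "v' \<in> \<O>"
      "r = a * u + of_nat y ^ k * v" "s = a * u' + of_nat y * v'"
      using Suc unfolding root_ideal_def by blast
    have "r * s = a * (u * (a * u' + of_nat y * v') + of_nat y ^ k * v * u') + of_nat y ^ Suc k * (v * v')"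
      using * by (simp add: algebra_simps)
    moreover have "u * (a * u' + of_nat y * v') + of_nat y ^ k * v * u' \<in> \<O>" "v * v' \<in> \<O>"
      by (intro integers_add integers_mult integers_power nat_integers a_integral *)+
    ultimately show "r * s \<in> {a * u + of_nat y ^ Suc k * v | u v. u \<in> \<O> \<and> v \<in> \<O>}" by blast
  next
    fix r s assume "r \<in> {a * u + of_nat y ^ Suc k * v | u v. u \<in> \<O> \<and> v \<in> \<O>}"
      "s \<in> {a * u + of_nat y ^ Suc k * v | u v. u \<in> \<O> \<and> v \<in> \<O>}"
    then obtain u v u' v' where *: "u \<in> \<O>" "v \<in> \<O>" "u' \<in> \<O>" "v' \<in> \<O>"
      "r = a * u + of_nat y ^ Suc k * v" "s = a * u' + of_nat y ^ Suc k * v'"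
      by blast
    have "r + s = a * (u + u') + of_nat y ^ Suc k * (v + v')" using * by (simp add: algebra_simps)
    moreover have "u + u' \<in> \<O>" "v + v' \<in> \<O>" using * integers_add by simp_all
    ultimately show "r + s \<in> {a * u + of_nat y ^ Suc k * v | u v. u \<in> \<O> \<and> v \<in> \<O>}" by blast
  qed
qed

lemma root_power_subset_integers: "root_power k \<subseteq> \<O>"
proof
  fix r assume "r \<in> root_power k"
  then obtain u v where *: "u \<in> \<O>" "v \<in> \<O>" "r = a * u + of_nat y ^ k * v" using root_power_subset by blast
  show "r \<in> \<O>" unfolding *(3) by (intro integers_add integers_mult integers_power nat_integers a_integral *)
qed

text \<open>
  The inclusion from left to right is the case \<open>k = n\<close> of \<open>root_power_subset\<close>, as
  \<open>y ^ n = a * cnj a\<close>. Therefore the product of the power with its conjugate lies in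
  \<open>cnj a\<close> times the power. By multiplicativity of norms this product contains \<open>y ^ n = a * cnj a\<close>,
  and cancelling \<open>cnj a\<close> puts \<open>a\<close> into the power.
\<close>

lemma root_power_n: "root_power n = a \<bullet> \<O>"
proof
  show sub: "root_power n \<subseteq> a \<bullet> \<O>"
  proof
    fix r assume "r \<in> root_power n"
    then obtain u v where *: "u \<in> \<O>" "v \<in> \<O>" "r = a * u + of_nat y ^ n * v" using root_power_subset by blast
    have "r = a * (u + cnj a * v)" using * by (simp add: distrib_left flip: norm_a)
    moreover have "u + cnj a * v \<in> \<O>" by (intro integers_add integers_mult integers_cnj a_integral *)
    ultimately show "r \<in> a \<bullet> \<O>" by (rule image_eqI)
  qed
  have "root_power n \<star> cnj ` root_power n \<subseteq> {cnj a * r | r. r \<in> root_power n}"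
  proof (rule span_prod_least)
    fix r s assume "r \<in> root_power n" "s \<in> cnj ` root_power n"
    then obtain u where u: "u \<in> \<O>" "s = cnj (a * u)" using sub by blast
    have "r * s = cnj a * (cnj u * r)" using u by simp
    moreover have "cnj u * r \<in> root_power n"
      using fractional_mult[OF fractional_root_power integers_cnj[OF u(1)]] \<open>r \<in> root_power n\<close> by simp
    ultimately show "r * s \<in> {cnj a * r | r. r \<in> root_power n}" by blast
  next
    fix r s assume "r \<in> {cnj a * r | r. r \<in> root_power n}" "s \<in> {cnj a * r | r. r \<in> root_power n}"
    then obtain u v where *: "u \<in> root_power n" "v \<in> root_power n" "r = cnj a * u" "s = cnj a * v" by blast
    have "r + s = cnj a * (u + v)" using * by (simp add: distrib_left)
    moreover have "u + v \<in> root_power n" using fractional_add[OF fractional_root_power] * by simp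
    ultimately show "r + s \<in> {cnj a * r | r. r \<in> root_power n}" by blast
  qed
  moreover have "a * cnj a \<in> root_power n \<star> cnj ` root_power n"
    unfolding root_power_norm norm_a by (rule scale_integers_mem)
  ultimately obtain r where "r \<in> root_power n" "a * cnj a = cnj a * r" by blast
  hence a: "a \<in> root_power n" using a_nonzero by simp
  show "a \<bullet> \<O> \<subseteq> root_power n"
  proof
    fix r assume "r \<in> a \<bullet> \<O>"
    then obtain u where "u \<in> \<O>" "r = u * a" by (auto simp: mult.commute)
    thus "r \<in> root_power n" using fractional_mult[OF fractional_root_power _ a] by simp
  qed
qed

section \<open>The class of the ideal has order \<open>n\<close>\<close>

text \<open>
  If the power with exponent \<open>n div p\<close> were generated by \<open>c\<close>, then \<open>a = u * c ^ p\<close> for a unit \<open>u\<close>, and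
  \<open>c\<close> has norm \<open>N = y ^ (n div p) \<ge> y\<close>. If \<open>u\<close> is a \<open>p\<close>-th power, then so is \<open>a\<close>, and its trace
  \<open>t\<close> is a term of a Lucas sequence with norm \<open>N\<close>, which bounds \<open>y\<close>. Otherwise \<open>a\<close> is a primitive
  cube root of unity times a cube of odd norm, so \<open>t\<close> is odd.
\<close>

lemma root_power_not_principal:
  assumes n: "odd n" and p: "Factorial_Ring.prime p" "p dvd n"
    and t: "t > 0" "even t" and y: "int y > int n * t ^ n + t"
  shows "root_power (n div p) \<notin> principal_fractional_ideals K"
proof
  assume "root_power (n div p) \<in> principal_fractional_ideals K"
  then obtain c where c: "c \<in> K" "c \<noteq> 0" "root_power (n div p) = c \<bullet> \<O>"
    unfolding principal_fractional_ideals_def by blast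
  interpret G: comm_group "fractional_ideal_group K" by (rule comm_group_fractional_ideal_group)
  have "odd p" using n p(2) by (meson dvd_trans)
  hence "p \<ge> 3" using prime_ge_2_nat[OF p(1)] by (cases "p = 2") auto
  have npp: "n div p * p = n" using p(2) by simp
  have "c \<in> c \<bullet> \<O>" by (rule scale_integers_mem)
  hence cO: "c \<in> \<O>" using c(3) root_power_subset_integers by blast
  have "c ^ p \<bullet> \<O> = root_power (n div p) [^]\<^bsub>fractional_ideal_group K\<^esub> p"
    unfolding c(3) by (rule principal_power[OF c(1,2), symmetric])
  also have "\<dots> = a \<bullet> \<O>"
    unfolding G.nat_pow_pow[OF root_ideal_carrier] npp root_power_n ..
  finally have "a \<bullet> \<O> = c ^ p \<bullet> \<O>" by simp
  then obtain u where u: "u \<in> \<O>" "u * cnj u = 1" "a = u * c ^ p"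
    using principal_eqD a_nonzero by blast
  obtain N :: int where N: "c * cnj c = of_int N" "N \<ge> 0" using norm_int_nonneg[OF cO] .
  have "of_int (N ^ p) = a * cnj a"
    using u by (simp add: power_mult_distrib flip: N(1))
  also have "\<dots> = of_int (int y ^ n)" by (simp add: norm_a)
  finally have Np: "N ^ p = int y ^ n" by (simp only: of_int_eq_iff)
  hence "N ^ p = (int y ^ (n div p)) ^ p" by (simp add: npp flip: power_mult)
  hence Ny: "N = int y ^ (n div p)"
    using N(2) \<open>p \<ge> 3\<close> power_eq_iff_eq_base[of p N "int y ^ (n div p)"] by simp
  have "n div p > 0" using npp n_pos by (cases "n div p") auto
  hence yN: "int y \<le> N" using y_pos self_le_power[of "int y" "n div p"] by (simp add: Ny)
  have trace: "\<exists>r. b + cnj b = of_int r" if "b \<in> \<O>" for b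
    using that integers_iff by (metis Ints_cases)
  have "u + cnj u \<in> \<int>" using u(1) integers_iff by blast
  from unit_is_pth_power_or_cube_root[OF u(2) this p(1) \<open>odd p\<close>] show False
  proof
    assume up: "u ^ (p * p) = u"
    define g where "g = u ^ p * c"
    have "g \<in> \<O>" unfolding g_def by (intro integers_mult integers_power u(1) cO)
    then obtain r where r: "g + cnj g = of_int r" using trace by blast
    have "g * cnj g = (u * cnj u) ^ p * (c * cnj c)" by (simp add: g_def power_mult_distrib)
    hence gN: "g * cnj g = of_int N" using u(2) N(1) by simp
    have "g ^ p = a" unfolding g_def u(3) by (simp add: power_mult_distrib up flip: power_mult)
    hence "of_int (lucas_V r N p) = (of_int t :: complex)"
      using power_sum_eq_lucas_V[OF r gN, of p] trace_a by (simp flip: complex_cnj_power)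
    hence "lucas_V r N p = t" by (simp only: of_int_eq_iff)
    hence "N \<le> int p * t ^ p + t"
      using lucas_V_bound[OF \<open>odd p\<close> \<open>p \<ge> 3\<close> t(1)] yN y_pos by simp
    moreover have "int p * t ^ p + t \<le> int n * t ^ n + t"
    proof -
      have "p \<le> n" using p(2) n_pos by (rule dvd_imp_le)
      hence "int p * t ^ p \<le> int n * t ^ n"
        using t(1) by (intro mult_mono power_increasing) auto
      thus ?thesis by simp
    qed
    ultimately show False using y yN by linarith
  next
    assume "p = 3 \<and> (\<exists>\<sigma>\<in>{1, - 1}. (\<sigma> * u) ^ 2 + \<sigma> * u + 1 = 0)"
    then obtain \<sigma> :: complex where \<sigma>: "p = 3" "\<sigma> = 1 \<or> \<sigma> = -1" "(\<sigma> * u) ^ 2 + \<sigma> * u + 1 = 0" by blast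
    \<comment> \<open>The sign \<open>\<sigma>\<close> is moved from the unit into the cube, as \<open>\<sigma> ^ 3 = \<sigma>\<close>.\<close>
    define w where "w = \<sigma> * u"
    define b where "b = \<sigma> * c"
    have ww: "w * cnj w = 1" using \<sigma>(2) u(2) by (auto simp: w_def)
    have w: "w ^ 2 + w + 1 = 0" using \<sigma>(3) by (simp add: w_def)
    have "w ^ 3 - 1 = (w - 1) * (w ^ 2 + w + 1)" by (simp add: algebra_simps power2_eq_square power3_eq_cube)
    hence "w ^ 3 = 1" using w by simp
    hence "cnj w = w ^ 3 * cnj w" by simp
    also have "\<dots> = w ^ 2 * (w * cnj w)" by (simp add: power3_eq_cube power2_eq_square mult_ac)
    finally have cw: "cnj w = w ^ 2" using ww by simp
    have wb: "w \<in> \<O>" "b \<in> \<O>"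
      using \<sigma>(2) u(1) cO integers_uminus[OF u(1)] integers_uminus[OF cO]
      unfolding w_def b_def by (elim disjE; simp only: mult_1_left mult_minus1)+
    obtain s r where s: "b + cnj b = of_int s" and r: "w * b + cnj (w * b) = of_int r"
      using trace wb integers_mult by meson
    have bN: "b * cnj b = of_int N" using N(1) \<sigma>(2) by (auto simp: b_def)
    have "w * b ^ 3 = a" using \<sigma>(1,2) u(3) by (auto simp: w_def b_def power3_eq_cube)
    hence "w * b ^ 3 + cnj (w * b ^ 3) = of_int t" using trace_a by simp
    moreover have "odd y"
      using t(2) coprime_trace coprime_common_divisor[of t "int y" 2] by auto
    hence "odd N" by (simp add: Ny)
    ultimately have "odd t" using trace_omega_cube_odd[OF w cw s r bN] by blast
    thus False using t(2) by simp
  qed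
qed

theorem dvd_class_number:
  assumes "odd n" "t > 0" "even t" "int y > int n * t ^ n + t"
  shows "n dvd class_number K"
  unfolding class_number_def ideal_class_group_def
proof (rule comm_group.dvd_order_Mod)
  show "comm_group (fractional_ideal_group K)" by (rule comm_group_fractional_ideal_group)
  show "subgroup (principal_fractional_ideals K) (fractional_ideal_group K)" by (rule subgroup_principal)
  show "root_ideal \<in> carrier (fractional_ideal_group K)" by (rule root_ideal_carrier)
  show "root_power n \<in> principal_fractional_ideals K"
    using a_integral a_nonzero integers_iff unfolding root_power_n principal_fractional_ideals_def by blast
  show "root_power (n div p) \<notin> principal_fractional_ideals K" if "Factorial_Ring.prime p" "p dvd n" for p
    using root_power_not_principal assms that by blast
qed (rule n_pos)

end

section \<open>Adjoining a purely imaginary square root\<close>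

lemma imaginary_quadratic_rat_adjoin:
  assumes s: "s ^ 2 \<in> \<rat>" "cnj s = - s"
  shows "imaginary_quadratic (rat_adjoin s)"
proof -
  \<comment> \<open>An element of \<open>\<rat> + \<rat> s\<close> has a rational trace, because \<open>cnj s = - s\<close>.\<close>
  define L where "L = {a + b * s | a b. a \<in> \<rat> \<and> b \<in> \<rat>}"
  have L_I: "a + b * s \<in> L" if "a \<in> \<rat>" "b \<in> \<rat>" for a b using that by (auto simp: L_def)
  have L_E: "\<exists>a b. a \<in> \<rat> \<and> b \<in> \<rat> \<and> z = a + b * s" if "z \<in> L" for z using that by (auto simp: L_def)
  have cnj_rat: "cnj a = a" if "a \<in> \<rat>" for a using that by (auto elim: Rats_cases')
  have L_mult: "z * w \<in> L" if zw: "z \<in> L" "w \<in> L" for z w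
  proof -
    obtain a b c d where *: "a \<in> \<rat>" "b \<in> \<rat>" "c \<in> \<rat>" "d \<in> \<rat>" "z = a + b * s" "w = c + d * s"
      using L_E zw by meson
    have "z * w = (a * c + b * d * s ^ 2) + (a * d + b * c) * s"
      using * by (simp add: algebra_simps power2_eq_square)
    thus ?thesis using * s(1) by (simp add: L_I)
  qed
  have mem: "z \<in> L \<and> cnj z \<in> rat_adjoin s" if "z \<in> rat_adjoin s" for z
    using that unfolding rat_adjoin_def
  proof (induction rule: generate_field.induct)
    case one
    show ?case using L_I[of 1 0] generate_field.one[of complex_ring "{s}"] by simp
  next
    case (incl h)
    hence "s \<in> generate_field complex_ring {s}" "h = s" by (auto intro: generate_field.incl)
    thus ?case using L_I[of 0 1] generate_field.a_inv[of s complex_ring "{s}"] s(2) by simp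
  next
    case (a_inv h)
    obtain a b where *: "a \<in> \<rat>" "b \<in> \<rat>" "h = a + b * s" using L_E a_inv by meson
    hence "- h \<in> L" using L_I[of "- a" "- b"] by simp
    thus ?case using generate_field.a_inv[of "cnj h" complex_ring "{s}"] a_inv by simp
  next
    case (m_inv h)
    obtain a b where *: "a \<in> \<rat>" "b \<in> \<rat>" "h = a + b * s" using L_E m_inv by meson
    define d where "d = h * cnj h"
    have c: "cnj h = a - b * s" using * cnj_rat s(2) by simp
    have "d = (a + b * s) * (a - b * s)" using c *(3) by (simp add: d_def)
    hence "d = a ^ 2 - b ^ 2 * s ^ 2" by (simp add: algebra_simps power2_eq_square)
    hence d: "d \<in> \<rat>" using * s(1) by simp
    have "inverse h = cnj h / d" using m_inv(2) by (simp add: d_def field_simps)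
    also have "\<dots> = a / d + (- b / d) * s" unfolding c by (simp add: diff_divide_distrib)
    also have "\<dots> \<in> L" using * d by (intro L_I) simp_all
    finally show ?case using generate_field.m_inv[of "cnj h" complex_ring "{s}"] m_inv by simp
  next
    case (eng_add h1 h2)
    obtain a b c d where *: "a \<in> \<rat>" "b \<in> \<rat>" "c \<in> \<rat>" "d \<in> \<rat>" "h1 = a + b * s" "h2 = c + d * s"
      using L_E eng_add by meson
    hence "h1 + h2 \<in> L" using L_I[of "a + c" "b + d"] by (simp add: algebra_simps)
    thus ?case using generate_field.eng_add[of "cnj h1" complex_ring "{s}" "cnj h2"] eng_add by simp
  next
    case (eng_mult h1 h2)
    thus ?case using generate_field.eng_mult[of "cnj h1" complex_ring "{s}" "cnj h2"] L_mult by simp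
  qed
  show ?thesis
  proof
    show "1 \<in> rat_adjoin s" using generate_field.one[of complex_ring] by (simp add: rat_adjoin_def)
    show "a + b \<in> rat_adjoin s" if "a \<in> rat_adjoin s" "b \<in> rat_adjoin s" for a b
      using generate_field.eng_add[of a complex_ring _ b] that by (simp add: rat_adjoin_def)
    show "a * b \<in> rat_adjoin s" if "a \<in> rat_adjoin s" "b \<in> rat_adjoin s" for a b
      using generate_field.eng_mult[of a complex_ring _ b] that by (simp add: rat_adjoin_def)
    show "- a \<in> rat_adjoin s" if "a \<in> rat_adjoin s" for a
      using generate_field.a_inv[of a complex_ring] that by (simp add: rat_adjoin_def)
    show "inverse a \<in> rat_adjoin s" if "a \<in> rat_adjoin s" "a \<noteq> 0" for a
      using generate_field.m_inv[of a complex_ring] that by (simp add: rat_adjoin_def)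
    show "cnj a \<in> rat_adjoin s" if "a \<in> rat_adjoin s" for a using mem that by blast
    show "z + cnj z \<in> \<rat>" if "z \<in> rat_adjoin s" for z
    proof -
      obtain a b where "a \<in> \<rat>" "b \<in> \<rat>" "z = a + b * s" using L_E mem \<open>z \<in> rat_adjoin s\<close> by meson
      thus ?thesis using cnj_rat s(2) by simp
    qed
  qed
qed

theorem theorem2:
  fixes x n :: nat
  assumes "x > 0" and "n > 0" and "odd n"
  shows "\<exists>C :: real. \<forall>y :: nat. y > 0 \<and> x ^ 2 < y ^ n \<and> gcd (2 * x) y = 1 \<and> real y > C \<longrightarrow>
    n dvd class_number (rat_adjoin (csqrt (of_nat x ^ 2 - of_nat y ^ n)))"
proof (intro exI allI impI, elim conjE)
  \<comment> \<open>The constant is the bound of \<open>lucas_V_bound\<close> at \<open>m = 2 * x\<close>, with the exponent enlarged to \<open>n\<close>.\<close>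
  fix y :: nat
  assume y: "y > 0" "x ^ 2 < y ^ n" "gcd (2 * x) y = 1" "real y > real (n * (2 * x) ^ n + 2 * x)"
  define D :: complex where "D = of_nat x ^ 2 - of_nat y ^ n"
  define s where "s = csqrt D"
  have D: "D = of_real (of_int (int (x ^ 2) - int (y ^ n)))" by (simp add: D_def)
  have D_neg: "real_of_int (int (x ^ 2) - int (y ^ n)) < 0" using y(2) by (simp flip: of_nat_power)
  have s2: "s ^ 2 = D" by (simp add: s_def)
  have "cnj s = - s" unfolding s_def D using D_neg by (subst (1 2) csqrt_of_real_nonpos) auto
  moreover have "s ^ 2 \<in> \<rat>" unfolding s2 D by (simp del: of_int_diff)
  ultimately interpret imaginary_quadratic "rat_adjoin s" by (rule_tac imaginary_quadratic_rat_adjoin)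
  let ?a = "of_nat x + s"
  have "s \<in> rat_adjoin s" by (simp add: rat_adjoin_def generate_field.incl)
  hence "?a \<in> rat_adjoin s" by (intro add_mem nat_mem)
  moreover have trace: "?a + cnj ?a = of_int (int (2 * x))" using \<open>cnj s = - s\<close> by simp
  moreover have norm: "?a * cnj ?a = of_nat y ^ n"
  proof -
    have "?a * cnj ?a = of_nat x ^ 2 - s ^ 2" using \<open>cnj s = - s\<close> by (simp add: algebra_simps power2_eq_square)
    thus ?thesis unfolding s2 by (simp add: D_def)
  qed
  moreover have "of_int (int (2 * x)) \<in> (\<int> :: complex set)" "of_nat y ^ n \<in> (\<int> :: complex set)" by simp_all
  ultimately have aO: "?a \<in> \<O>" unfolding integers_iff by (simp only: simp_thms)
  interpret coprime_norm_power "rat_adjoin s" ?a y n "int (2 * x)"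
  proof
    show "coprime (int (2 * x)) (int y)"
      using y(3) unfolding coprime_int_iff by (simp add: coprime_iff_gcd_eq_1)
  qed (use aO norm trace y(1) assms(2) in auto)
  have "n * (2 * x) ^ n + 2 * x < y" using y(4) by (simp only: of_nat_less_iff)
  hence "int (n * (2 * x) ^ n + 2 * x) < int y" by (simp only: of_nat_less_iff)
  hence "int n * int (2 * x) ^ n + int (2 * x) < int y" by simp
  hence "n dvd class_number (rat_adjoin s)" using assms by (intro dvd_class_number) auto
  thus "n dvd class_number (rat_adjoin (csqrt (of_nat x ^ 2 - of_nat y ^ n)))"
    by (simp only: s_def D_def)
qed

end
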